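(* Let $m\ge 3$ be an integer. (i) If $2\nmid m$ or $4\mid m$, then every integer $N\ge 1628m^3$ can be written as $p_{m+2}(x_1)+p_{m+2}(x_2)+2p_{m+2}(x_3)+2p_{m+2}(x_4)$ with $x_1,x_2,x_3,x_4\in\mathbb{N}$. (ii) If $m\equiv 2\pmod 4$, then there are infinitely many positive integers that cannot be written as $p_{m+2}(x_1)+p_{m+2}(x_2)+2p_{m+2}(x_3)+2p_{m+2}(x_4)$ with $x_1,x_2,x_3,x_4\in\mathbb{N}$.
   Context: $\mathbb{N}=\{0,1,2,\dots\}$. For integers $m\ge1$ and $n$, $p_{m+2}(n)=m\binom n2+n=\frac{mn^2-(m-2)n}{2}$. *)

theory Defs
  imports Main
begin

(* The first argument is the order of the polygon, so p_{m+2}(n) is polygonal (m + 2) n.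
   The binomial coefficient "n choose 2" at an integer n is n * (n - 1) div 2, an exact
   division. *)
definition polygonal :: "int \<Rightarrow> int \<Rightarrow> int" where
  "polygonal k n = (k - 2) * (n * (n - 1) div 2) + n"

lemma polygonal_eq:
  "polygonal (m + 2) n = (m * n\<^sup>2 - (m - 2) * n) div 2"
proof -
  have "even (n * (n - 1))"
    by simp
  then obtain c where c: "n * (n - 1) = 2 * c"
    by (rule dvdE)
  have "m * n\<^sup>2 - (m - 2) * n = m * (n * (n - 1)) + 2 * n"
    by (simp add: algebra_simps power2_eq_square)
  also have "\<dots> = 2 * (m * c + n)"
    unfolding c by (simp add: algebra_simps)
  finally show ?thesis
    by (simp add: polygonal_def c)
qed

lemma polygonal_of_nat:
  "polygonal (m + 2) (int n) = m * int (n choose 2) + int n"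
proof -
  have "int (n * (n - 1)) = int n * (int n - 1)"
    by (cases n) (simp_all add: algebra_simps)
  then have "int (n choose 2) = int n * (int n - 1) div 2"
    by (metis choose_two of_nat_div of_nat_numeral)
  then show ?thesis
    by (simp add: polygonal_def)
qed

end

theory Submission
  imports Defs "HOL-Number_Theory.Number_Theory" "HOL-Computational_Algebra.Squarefree"
begin

text \<open>
  Writing \<open>a = x\<^sub>1\<^sup>2 + x\<^sub>2\<^sup>2 + 2 * x\<^sub>3\<^sup>2 + 2 * x\<^sub>4\<^sup>2\<close> and \<open>b = x\<^sub>1 + x\<^sub>2 + 2 * x\<^sub>3 + 2 * x\<^sub>4\<close>, the number
  represented is \<open>m * (a - b) / 2 + b\<close>. As in Cauchy's lemma, a pair \<open>(a, b)\<close> of equal parity with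
  \<open>5 * a \<le> b\<^sup>2\<close> arises from nonnegative \<open>x\<^sub>i\<close> as soon as \<open>6 * a - b\<^sup>2\<close> is a value of
  \<open>2 * u\<^sup>2 + 3 * v\<^sup>2 + 6 * w\<^sup>2\<close>, and for numbers not congruent to 1 modulo 3 this amounts to being a
  sum of three squares. The freedom in \<open>b\<close> allows one to make \<open>6 * a - b\<^sup>2\<close>, up to a factor 4,
  congruent to 1 modulo 4.

  That every \<open>n \<equiv> 1\<close> modulo 4 is a sum of three squares follows, for squarefree \<open>n\<close>, by writing
  \<open>n\<close> as a diagonal entry of a positive definite integral ternary form of determinant 1, which
  reduction theory identifies with \<open>x\<^sup>2 + y\<^sup>2 + z\<^sup>2\<close>. Constructing that form needs a prime with prescribed
  values of quadratic characters, so only the part of Dirichlet's theorem concerning real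
  characters is required: \<open>L(1, \<chi>) \<noteq> 0\<close> is proved by Monsky's argument with Lambert series, and the
  sums of \<open>\<chi>(n) \<Lambda>(n) / n\<close> are then bounded as in Mertens' theorem.

  For \<open>m \<equiv> 2\<close> modulo 4, completing the square leads to a form that is anisotropic over the 2-adic
  numbers; a suitable family growing like a power of 4 then admits only representations
  descending from those of one small number, which congruences modulo \<open>m / 2\<close> exclude.
\<close>

section \<open>Reduction of unimodular ternary forms\<close>

text \<open>Gram matrix convention: diagonal entries \<open>a\<close>, \<open>b\<close>,
  \<open>c\<close>, with \<open>t\<close> at position (1,2), \<open>s\<close> at (1,3) and
  \<open>r\<close> at (2,3). The factors 2 make this matrix integral, and \<open>ternary_det\<close>
  is its determinant.\<close>

definition ternary_form :: "int \<Rightarrow> int \<Rightarrow> int \<Rightarrow> int \<Rightarrow> int \<Rightarrow> int \<Rightarrow> int \<Rightarrow> int \<Rightarrow> int \<Rightarrow> int"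
  where "ternary_form a b c r s t x y z =
    a * x\<^sup>2 + b * y\<^sup>2 + c * z\<^sup>2 + 2 * r * y * z + 2 * s * x * z + 2 * t * x * y"

definition ternary_det :: "int \<Rightarrow> int \<Rightarrow> int \<Rightarrow> int \<Rightarrow> int \<Rightarrow> int \<Rightarrow> int"
  where "ternary_det a b c r s t = a * b * c + 2 * r * s * t - a * r\<^sup>2 - b * s\<^sup>2 - c * t\<^sup>2"

definition sum_three_squares :: "int \<Rightarrow> bool"
  where "sum_three_squares n \<longleftrightarrow> (\<exists>x y z. n = x\<^sup>2 + y\<^sup>2 + z\<^sup>2)"

lemma exists_small_shift:
  fixes a t :: int
  assumes "a > 0"
  obtains j where "\<bar>2 * (t + j * a)\<bar> \<le> a"
proof -
  \<comment> \<open>Minus the integer nearest to \<open>t / a\<close>, found by rounding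
    \<open>t / a + 1 / 2\<close> down.\<close>
  define j where "j = - ((2 * t + a) div (2 * a))"
  have "2 * t + a = (2 * a) * ((2 * t + a) div (2 * a)) + (2 * t + a) mod (2 * a)" by simp
  moreover have "0 \<le> (2 * t + a) mod (2 * a)" "(2 * t + a) mod (2 * a) < 2 * a"
    using assms by auto
  ultimately have "\<bar>2 * (t + j * a)\<bar> \<le> a"
    unfolding j_def by (simp add: algebra_simps abs_le_iff)
  then show ?thesis by (rule that)
qed

lemma four_square_le_of_abs_le:
  fixes a t :: int
  assumes "\<bar>2 * t\<bar> \<le> a"
  shows "4 * t\<^sup>2 \<le> a\<^sup>2"
  using power_mono[OF assms, of 2] by (simp add: power_mult_distrib)

lemma ternary_form_swap12:
  "ternary_form a b c r s t x y z = ternary_form b a c s r t y x z"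
  by (simp add: ternary_form_def algebra_simps)

lemma ternary_form_swap23:
  "ternary_form a b c r s t x y z = ternary_form a c b r t s x z y"
  by (simp add: ternary_form_def algebra_simps)

lemma ternary_form_shift12:
  "ternary_form a b c r s t x y z =
   ternary_form a (b + 2 * j * t + j\<^sup>2 * a) c (r + j * s) s (t + j * a) (x - j * y) y z"
  by (simp add: ternary_form_def algebra_simps power2_eq_square)

lemma ternary_form_shift23:
  "ternary_form a b c r s t x y z =
   ternary_form a b (c + 2 * j * r + j\<^sup>2 * b) (r + j * b) (s + j * t) t x (y - j * z) z"
  by (simp add: ternary_form_def algebra_simps power2_eq_square)

lemma ternary_det_swap12: "ternary_det b a c s r t = ternary_det a b c r s t"
  by (simp add: ternary_det_def algebra_simps)

lemma ternary_det_swap23: "ternary_det a c b r t s = ternary_det a b c r s t"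
  by (simp add: ternary_det_def algebra_simps)

lemma ternary_det_shift12:
  "ternary_det a (b + 2 * j * t + j\<^sup>2 * a) c (r + j * s) s (t + j * a) = ternary_det a b c r s t"
  by (simp add: ternary_det_def algebra_simps power2_eq_square)

lemma ternary_det_shift23:
  "ternary_det a b (c + 2 * j * r + j\<^sup>2 * b) (r + j * b) (s + j * t) t = ternary_det a b c r s t"
  by (simp add: ternary_det_def algebra_simps power2_eq_square)

text \<open>
  Both minors \<open>a * b - t\<^sup>2\<close> and \<open>a * c - s\<^sup>2\<close> are leading coefficients of the binary form
  of determinant \<open>a\<close> that remains after completing the square in the first variable.
\<close>
lemma ternary_minor_identity:
  "(a * b - t\<^sup>2) * (a * c - s\<^sup>2) - (a * r - s * t)\<^sup>2 = a * ternary_det a b c r s t"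
  by (simp add: ternary_det_def algebra_simps power2_eq_square)

text \<open>The larger of the two numbers, say \<open>x\<close>, satisfies
  \<open>3 * x\<^sup>2 \<le> 4 * x\<close>, hence \<open>x \<le> 1\<close>.\<close>

lemma reduced_bounds:
  fixes a A :: int
  assumes "0 < a" "0 < A" "3 * a\<^sup>2 \<le> 4 * A" "3 * A\<^sup>2 \<le> 4 * a"
  shows "a = 1" "A = 1"
proof -
  have "a \<le> 1"
  proof (rule ccontr)
    assume "\<not> a \<le> 1"
    show False
    proof (cases "a \<le> A")
      case True
      then have "2 * A \<le> A\<^sup>2" using \<open>\<not> a \<le> 1\<close> by (simp add: power2_eq_square)
      then show False using assms True \<open>\<not> a \<le> 1\<close> by linarith
    next
      case False
      then have "2 * a \<le> a\<^sup>2" using \<open>\<not> a \<le> 1\<close> by (simp add: power2_eq_square)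
      then show False using assms False \<open>\<not> a \<le> 1\<close> by linarith
    qed
  qed
  with assms show "a = 1" by simp
  have "A \<le> 1"
  proof (rule ccontr)
    assume "\<not> A \<le> 1"
    then have "2 * A \<le> A\<^sup>2" by (simp add: power2_eq_square)
    then show False using assms \<open>a = 1\<close> \<open>\<not> A \<le> 1\<close> by linarith
  qed
  with assms show "A = 1" by simp
qed

text \<open>Lexicographic descent on the leading entry \<open>a\<close> and the leading minor
  \<open>A = a * b - t\<^sup>2\<close>. After a shift, swapping the first two variables lowers
  \<open>a\<close> unless \<open>a \<le> b'\<close>; swapping the last two keeps \<open>a\<close>
  and lowers the minor unless \<open>A \<le> C\<close>. If neither applies, the bounds of binary
  reduction force \<open>a = A = 1\<close>, and completing squares finishes.\<close>

lemma unimodular_ternary_form_sum_three_squares: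
  assumes "a > 0" "a * b - t\<^sup>2 > 0" "ternary_det a b c r s t = 1"
  shows "sum_three_squares (ternary_form a b c r s t x y z)"
  using assms
proof (induction "(nat a, nat (a * b - t\<^sup>2))" arbitrary: a b c r s t x y z
       rule: wf_induct_rule[OF wf_lex_prod[OF wf_less_than wf_less_than]])
  case 1
  note IH = "1.hyps" and pos = "1.prems"(1,2) and det = "1.prems"(3)
  define A where "A = a * b - t\<^sup>2"
  obtain j where j: "\<bar>2 * (t + j * a)\<bar> \<le> a" using exists_small_shift[OF pos(1)] .
  define b' where "b' = b + 2 * j * t + j\<^sup>2 * a"
  define t' where "t' = t + j * a"
  define r' where "r' = r + j * s"
  have minor12: "a * b' - t'\<^sup>2 = A"
    by (simp add: A_def b'_def t'_def algebra_simps power2_eq_square)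
  have det12: "ternary_det a b' c r' s t' = 1"
    using det by (simp add: b'_def t'_def r'_def ternary_det_shift12)
  have form12: "ternary_form a b c r s t x y z = ternary_form a b' c r' s t' (x - j * y) y z"
    unfolding b'_def t'_def r'_def by (rule ternary_form_shift12)
  have "0 < a * b'" using minor12 pos(2) A_def by (smt (verit) zero_le_power2)
  then have b'pos: "0 < b'" using pos(1) by (simp add: zero_less_mult_iff)
  \<comment> \<open>Completing the square in the first variable leaves a binary form with
    coefficients \<open>A\<close>, \<open>B\<close>, \<open>C\<close> and determinant
    \<open>a\<close>; this shift makes its middle coefficient small.\<close>
  obtain i where i: "\<bar>2 * ((a * r - s * t) + i * A)\<bar> \<le> A"
    using exists_small_shift[of A] pos(2) A_def by blast
  define c' where "c' = c + 2 * i * r + i\<^sup>2 * b"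
  define s' where "s' = s + i * t"
  define r'' where "r'' = r + i * b"
  have det23: "ternary_det a b c' r'' s' t = 1"
    using det by (simp add: c'_def s'_def r''_def ternary_det_shift23)
  have form23: "ternary_form a b c r s t x y z = ternary_form a b c' r'' s' t x (y - i * z) z"
    unfolding c'_def s'_def r''_def by (rule ternary_form_shift23)
  define B where "B = a * r'' - s' * t"
  define C where "C = a * c' - s'\<^sup>2"
  have B: "\<bar>2 * B\<bar> \<le> A"
    using i by (simp add: B_def r''_def s'_def A_def algebra_simps power2_eq_square)
  have AC: "A * C - B\<^sup>2 = a"
    using ternary_minor_identity[of a b t c' s' r''] det23 by (simp add: A_def B_def C_def)
  have "0 < A * C" using AC pos(1) by (smt (verit) zero_le_power2)
  then have Cpos: "0 < C" using pos(2) A_def by (simp add: zero_less_mult_iff)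
  show ?case
  proof (cases "b' < a")
    case True
    then have "sum_three_squares (ternary_form b' a c s r' t' y (x - j * y) z)"
      using pos b'pos minor12 det12 A_def
      by (intro IH) (simp_all add: ternary_det_swap12 mult.commute)
    then show ?thesis by (simp add: form12 ternary_form_swap12[of a b'])
  next
    case ba: False
    show ?thesis
    proof (cases "C < A")
      case True
      then have "sum_three_squares (ternary_form a c' b r'' t s' x z (y - i * z))"
        using pos Cpos det23
        by (intro IH) (simp_all add: ternary_det_swap23 A_def C_def)
      then show ?thesis by (simp add: form23 ternary_form_swap23[of a b c'])
    next
      case False
      have "a * a \<le> a * b'" using ba pos(1) by simp
      then have "a\<^sup>2 \<le> A + t'\<^sup>2" using minor12 by (simp add: power2_eq_square)
      moreover have "4 * t'\<^sup>2 \<le> a\<^sup>2" using four_square_le_of_abs_le j t'_def by blast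
      ultimately have 1: "3 * a\<^sup>2 \<le> 4 * A" by linarith
      have "A * A \<le> A * C" using False pos(2) A_def by simp
      then have "A\<^sup>2 \<le> a + B\<^sup>2" using AC by (simp add: power2_eq_square)
      moreover have "4 * B\<^sup>2 \<le> A\<^sup>2" using four_square_le_of_abs_le B by blast
      ultimately have 2: "3 * A\<^sup>2 \<le> 4 * a" by linarith
      have a1: "a = 1" and A1: "A = 1" using reduced_bounds[OF _ _ 1 2] pos A_def by auto
      have "B = 0" using B A1 by linarith
      then have "C = 1" using AC a1 A1 by simp
      have "r'' = s' * t" "c' = 1 + s'\<^sup>2" "b = 1 + t\<^sup>2"
        using \<open>B = 0\<close> \<open>C = 1\<close> A1 a1 by (simp_all add: B_def C_def A_def)
      then have "ternary_form a b c r s t x y z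
          = (x + t * (y - i * z) + s' * z)\<^sup>2 + (y - i * z)\<^sup>2 + z\<^sup>2"
        unfolding form23 unfolding a1 by (simp add: ternary_form_def algebra_simps power2_eq_square)
      then show ?thesis unfolding sum_three_squares_def by blast
    qed
  qed
qed

text \<open>The matrix used has diagonal \<open>q * k\<close>, \<open>m\<close>, \<open>n\<close>.
  Its leading minor is \<open>k\<close>, its determinant factors as
  \<open>(n * k - t\<^sup>2 * q) * (q * m - k * b\<^sup>2) = 1\<close>, and \<open>n\<close> is its
  value at (0, 0, 1).\<close>

lemma sum_three_squares_criterion:
  fixes n q k m t b :: int
  assumes "q > 0" "k > 0" "n * k = t\<^sup>2 * q + 1" "q * m = k * b\<^sup>2 + 1"
  shows "sum_three_squares n"
proof -
  have minor: "q * k * m - (b * k)\<^sup>2 = k"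
  proof -
    have "q * k * m - (b * k)\<^sup>2 = k * (q * m - k * b\<^sup>2)" by (simp add: algebra_simps power2_eq_square)
    then show ?thesis using assms(4) by simp
  qed
  have "ternary_det (q * k) m n (t * b) (t * q) (b * k)
      = n * (q * k * m - (b * k)\<^sup>2) - t\<^sup>2 * q * (q * m - k * b\<^sup>2)"
    by (simp add: ternary_det_def algebra_simps power2_eq_square)
  also have "\<dots> = 1" using minor assms(3,4) by simp
  finally have "ternary_det (q * k) m n (t * b) (t * q) (b * k) = 1" .
  then have "sum_three_squares (ternary_form (q * k) m n (t * b) (t * q) (b * k) 0 0 1)"
    using assms minor by (intro unimodular_ternary_form_sum_three_squares) auto
  then show ?thesis by (simp add: ternary_form_def)
qed

section \<open>Sums over the von Mangoldt function\<close>

text \<open>Write \<open>n = d * j\<close> and group the pairs by \<open>d\<close>. This serves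
  \<open>ln (fact N)\<close>, the Mertens estimate and the Lambert series alike.\<close>

lemma sum_over_divisors_swap:
  fixes g :: "nat \<Rightarrow> nat \<Rightarrow> 'a :: comm_monoid_add"
  shows "(\<Sum>n\<in>{1..N}. \<Sum>d | d dvd n. g d (n div d)) = (\<Sum>d\<in>{1..N}. \<Sum>j\<in>{1..N div d}. g d j)"
proof -
  have "(\<Sum>n\<in>{1..N}. \<Sum>d | d dvd n. g d (n div d))
      = (\<Sum>(n, d)\<in>(SIGMA n:{1..N}. {d. d dvd n}). g d (n div d))"
    by (subst sum.Sigma) auto
  also have "\<dots> = (\<Sum>(d, j)\<in>(SIGMA d:{1..N}. {1..N div d}). g d j)"
  proof (rule sum.reindex_bij_witness[where i = "\<lambda>(d, j). (d * j, d)" and j = "\<lambda>(n, d). (d, n div d)"])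
    fix a assume "a \<in> (SIGMA n:{1..N}. {d. d dvd n})"
    then obtain n d where a: "a = (n, d)" "1 \<le> n" "n \<le> N" "d dvd n" by auto
    then have "d \<noteq> 0" "d \<le> n" by (auto dest: dvd_imp_le)
    moreover have "n div d \<le> N div d" using a by (intro div_le_mono)
    moreover have "n div d \<ge> 1" using a \<open>d \<noteq> 0\<close> by (auto elim!: dvdE)
    ultimately show "(case a of (n, d) \<Rightarrow> (d, n div d)) \<in> (SIGMA d:{1..N}. {1..N div d})"
      using a by auto
    show "(case case a of (n, d) \<Rightarrow> (d, n div d) of (d, j) \<Rightarrow> (d * j, d)) = a" using a by simp
    show "(case case a of (n, d) \<Rightarrow> (d, n div d) of (d, j) \<Rightarrow> g d j) = (case a of (n, d) \<Rightarrow> g d (n div d))"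
      by (simp add: a(1))
  next
    fix b assume "b \<in> (SIGMA d:{1..N}. {1..N div d})"
    then obtain d j where b: "b = (d, j)" "1 \<le> d" "d \<le> N" "1 \<le> j" "j \<le> N div d" by auto
    then have "j * d \<le> N" by (simp add: less_eq_div_iff_mult_less_eq)
    then show "(case b of (d, j) \<Rightarrow> (d * j, d)) \<in> (SIGMA n:{1..N}. {d. d dvd n})"
      using b by (auto simp: mult.commute)
    show "(case case b of (d, j) \<Rightarrow> (d * j, d) of (n, d) \<Rightarrow> (d, n div d)) = b" using b by simp
  qed
  also have "\<dots> = (\<Sum>d\<in>{1..N}. \<Sum>j\<in>{1..N div d}. g d j)"
    by (subst sum.Sigma) auto
  finally show ?thesis .
qed

lemma ln_fact_eq_sum: "ln (fact N :: real) = (\<Sum>n\<in>{1..N}. ln (real n))"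
  unfolding fact_prod by (subst of_nat_prod, subst ln_prod) auto

lemma ln_fact_mangoldt: "ln (fact N) = (\<Sum>d\<in>{1..N}. mangoldt d * real (N div d))"
proof -
  have "ln (fact N :: real) = (\<Sum>n\<in>{1..N}. \<Sum>d | d dvd n. mangoldt d)"
    unfolding ln_fact_eq_sum by (intro sum.cong refl) (simp add: mangoldt_sum)
  also have "\<dots> = (\<Sum>d\<in>{1..N}. \<Sum>j\<in>{1..N div d}. mangoldt d)"
    by (rule sum_over_divisors_swap)
  finally show ?thesis by (simp add: mult.commute)
qed

text \<open>Chebyshev's central binomial argument: in \<open>ln ((2 * M) choose M)\<close> the
  coefficient of \<open>mangoldt d\<close> is never negative and is at least 1 for
  \<open>M < d \<le> 2 * M\<close>, while the binomial is at most
  \<open>2 ^ (2 * M)\<close>.\<close>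

lemma sum_mangoldt_double: "(\<Sum>d\<in>{1..2 * M}. mangoldt d) \<le> (\<Sum>d\<in>{1..M}. mangoldt d) + 2 * real M * ln 2"
proof -
  have split: "{1..2 * M} = {1..M} \<union> {M<..2 * M}" by auto
  have T2: "ln (fact (2 * M)) = (\<Sum>d\<in>{1..2 * M}. mangoldt d * real (2 * M div d))"
    by (rule ln_fact_mangoldt)
  have "ln (fact M :: real) = (\<Sum>d\<in>{1..2 * M}. mangoldt d * real (M div d))"
    unfolding ln_fact_mangoldt by (intro sum.mono_neutral_left) auto
  then have diff: "ln (fact (2 * M)) - 2 * ln (fact M)
      = (\<Sum>d\<in>{1..2 * M}. mangoldt d * (real (2 * M div d) - 2 * real (M div d)))"
    unfolding T2 by (simp add: sum_distrib_left sum_subtractf[symmetric] algebra_simps)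
  have "(\<Sum>d\<in>{M<..2 * M}. mangoldt d)
      \<le> (\<Sum>d\<in>{M<..2 * M}. mangoldt d * (real (2 * M div d) - 2 * real (M div d)))"
  proof (intro sum_mono)
    fix d assume "d \<in> {M<..2 * M}"
    then have "M div d = 0" "1 \<le> 2 * M div d" by (simp_all add: less_eq_div_iff_mult_less_eq)
    then show "mangoldt d \<le> mangoldt d * (real (2 * M div d) - 2 * real (M div d))"
      using mult_left_mono[of 1 "real (2 * M div d)" "mangoldt d"] mangoldt_nonneg[of d] by simp
  qed
  also have "\<dots> \<le> (\<Sum>d\<in>{1..2 * M}. mangoldt d * (real (2 * M div d) - 2 * real (M div d)))"
  proof (intro sum_mono2 mult_nonneg_nonneg mangoldt_nonneg)
    fix d
    have "2 * (M div d) \<le> 2 * M div d"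
      by (cases "d = 0") (simp_all add: less_eq_div_iff_mult_less_eq)
    then show "0 \<le> real (2 * M div d) - 2 * real (M div d)" by simp
  qed auto
  also have "\<dots> = ln (real ((2 * M) choose M))"
  proof -
    have "real ((2 * M) choose M) = fact (2 * M) / (fact M * fact M)"
      by (subst binomial_fact) auto
    then show ?thesis unfolding diff[symmetric] by (simp add: ln_div ln_mult)
  qed
  also have "\<dots> \<le> ln (real (2 ^ (2 * M)))"
  proof -
    have "real ((2 * M) choose M) \<le> real (2 ^ (2 * M))"
      using binomial_le_pow2[of "2 * M" M] by (simp only: of_nat_le_iff)
    moreover have "0 < real ((2 * M) choose M)" by (simp add: zero_less_binomial)
    ultimately show ?thesis by (subst ln_le_cancel_iff) auto
  qed
  also have "\<dots> = 2 * real M * ln 2" by (simp add: ln_realpow)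
  finally show ?thesis
    unfolding split by (subst sum.union_disjoint) auto
qed

lemma Chebyshev_upper_bound: "(\<Sum>d\<in>{1..N}. mangoldt d :: real) \<le> 4 * real N"
proof (induction N rule: less_induct)
  case (less N)
  have ln2: "ln 2 \<le> (1::real)" using ln_2_less_1 by simp
  show ?case
  proof (cases "N \<le> 1")
    case True
    then have "N = 0 \<or> N = 1" by auto
    then show ?thesis by auto
  next
    case False
    \<comment> \<open>Halving with rounding up. Since \<open>ln 2 \<le> 1\<close>, the induction
      costs \<open>4 * M + 2 * M\<close>, and \<open>3 * M \<le> 2 * N\<close> for
      \<open>N \<ge> 2\<close> brings this below \<open>4 * N\<close>.\<close>
    define M where "M = (N + 1) div 2"
    have M: "M < N" "N \<le> 2 * M" "2 * M \<le> N + 1" using False by (auto simp: M_def)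
    have "(\<Sum>d\<in>{1..N}. mangoldt d :: real) \<le> (\<Sum>d\<in>{1..2 * M}. mangoldt d)"
      using M by (intro sum_mono2) (auto simp: mangoldt_nonneg)
    also have "\<dots> \<le> (\<Sum>d\<in>{1..M}. mangoldt d) + 2 * real M * ln 2" by (rule sum_mangoldt_double)
    also have "\<dots> \<le> 4 * real M + 2 * real M * 1"
      using less.IH[OF M(1)] ln2 by (intro add_mono mult_left_mono) auto
    also have "\<dots> \<le> 4 * real N"
    proof -
      have "3 * M \<le> 2 * N" using M(3) False by presburger
      then show ?thesis by simp
    qed
    finally show ?thesis .
  qed
qed

text \<open>A crude half of Mertens' theorem: the upper half of the factors of
  \<open>fact (2 * K)\<close> gives \<open>K * ln K\<close>, and \<open>2 * K div d\<close> is at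
  most \<open>2 * K / d\<close>. The point is that the sum diverges.\<close>

lemma sum_mangoldt_over_lower_bound: "ln (real K) / 2 \<le> (\<Sum>d\<in>{1..2 * K}. mangoldt d / real d)"
proof (cases "K = 0")
  case False
  have "real K * ln (real K) = (\<Sum>n\<in>{K<..2 * K}. ln (real K))" by simp
  also have "\<dots> \<le> (\<Sum>n\<in>{K<..2 * K}. ln (real n))" using False by (intro sum_mono) auto
  also have "\<dots> \<le> (\<Sum>n\<in>{1..2 * K}. ln (real n))" by (intro sum_mono2) auto
  also have "\<dots> = (\<Sum>d\<in>{1..2 * K}. mangoldt d * real (2 * K div d))"
    by (simp only: ln_fact_eq_sum[symmetric] ln_fact_mangoldt)
  also have "\<dots> \<le> (\<Sum>d\<in>{1..2 * K}. mangoldt d * (real (2 * K) / real d))"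
    by (intro sum_mono mult_left_mono mangoldt_nonneg of_nat_div_le_of_nat)
  also have "\<dots> = 2 * real K * (\<Sum>d\<in>{1..2 * K}. mangoldt d / real d)"
    by (simp add: sum_distrib_left mult_ac)
  finally show ?thesis using False by (simp add: field_simps)
qed auto

text \<open>Summation by parts: the partial sums are weighted by the nonnegative differences
  \<open>g i - g (Suc i)\<close>, which telescope.\<close>

lemma Abel_bound:
  fixes f g :: "nat \<Rightarrow> real"
  assumes partial: "\<And>n. \<bar>\<Sum>i\<in>{a..<n}. f i\<bar> \<le> B"
    and antitone: "\<And>i. i \<ge> a \<Longrightarrow> g (Suc i) \<le> g i" and nonneg: "\<And>i. i \<ge> a \<Longrightarrow> g i \<ge> 0"
  shows "\<bar>\<Sum>i\<in>{a..<n}. f i * g i\<bar> \<le> B * g a"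
proof (cases "a \<le> n")
  case True
  define S where "S n = (\<Sum>i\<in>{a..<n}. f i)" for n
  have "(\<Sum>i\<in>{a..<n}. f i * g i) = S n * g n + (\<Sum>i\<in>{a..<n}. S (Suc i) * (g i - g (Suc i)))"
    using True by (induction n rule: dec_induct) (auto simp: S_def algebra_simps)
  also have "\<bar>\<dots>\<bar> \<le> B * g n + (\<Sum>i\<in>{a..<n}. B * (g i - g (Suc i)))"
  proof (intro order.trans[OF abs_triangle_ineq] add_mono order.trans[OF sum_abs] sum_mono)
    show "\<bar>S n * g n\<bar> \<le> B * g n"
      using partial nonneg[OF True] by (simp add: abs_mult S_def mult_right_mono)
    fix i assume "i \<in> {a..<n}"
    then show "\<bar>S (Suc i) * (g i - g (Suc i))\<bar> \<le> B * (g i - g (Suc i))"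
      using partial[of "Suc i"] antitone[of i] unfolding abs_mult S_def by (intro mult_mono) auto
  qed
  also have "(\<Sum>i\<in>{a..<n}. B * (g i - g (Suc i))) = B * (g a - g n)"
    unfolding sum_distrib_left[symmetric] using True by (subst sum_Suc_diff'[of a n "\<lambda>i. - g i", simplified, symmetric]) (auto simp: algebra_simps)
  finally show ?thesis by (simp add: algebra_simps)
next
  case False
  then show ?thesis using partial[of a] nonneg[of a] by simp
qed

section \<open>Real characters\<close>

text \<open>Real Dirichlet characters; the vanishing sum over a period expresses that the character
  is nonprincipal.\<close>

locale real_character =
  fixes \<chi> :: "nat \<Rightarrow> real" and Q :: nat
  assumes Q_pos: "Q > 0"
    and mult: "\<chi> (m * n) = \<chi> m * \<chi> n"
    and periodic: "\<chi> (n + Q) = \<chi> n"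
    and range: "\<chi> n \<in> {-1, 0, 1}"
    and one [simp]: "\<chi> 1 = 1"
    and sum_zero: "(\<Sum>n<Q. \<chi> n) = 0"
begin

lemma abs_le_1: "\<bar>\<chi> n\<bar> \<le> 1"
  using range[of n] by auto

lemma power: "\<chi> (n ^ k) = \<chi> n ^ k"
  using one by (induction k) (auto simp: mult)

text \<open>Full periods cancel, leaving at most \<open>Q\<close> terms of modulus at most
  1.\<close>

lemma partial_sum_bound: "\<bar>\<Sum>i<n. \<chi> i\<bar> \<le> real Q"
proof (induction n rule: less_induct)
  case (less n)
  show ?case
  proof (cases "n \<le> Q")
    case True
    have "\<bar>\<Sum>i<n. \<chi> i\<bar> \<le> (\<Sum>i<n. 1)"
      by (rule order.trans[OF sum_abs sum_mono]) (rule abs_le_1)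
    then show ?thesis using True by simp
  next
    case False
    have "{..<n} = {..<Q} \<union> {Q..<n}" using False by auto
    then have "(\<Sum>i<n. \<chi> i) = (\<Sum>i\<in>{Q..<n}. \<chi> i)"
      using sum_zero by (simp add: sum.union_disjoint ivl_disj_int)
    also have "\<dots> = (\<Sum>i<n - Q. \<chi> i)"
    proof (rule sum.reindex_bij_witness[where i = "\<lambda>i. i + Q" and j = "\<lambda>i. i - Q"])
      fix i assume "i \<in> {Q..<n}"
      then show "\<chi> (i - Q) = \<chi> i" using periodic[of "i - Q"] by simp
    qed auto
    finally show ?thesis using less.IH[of "n - Q"] Q_pos False by simp
  qed
qed

lemma interval_sum_bound: "\<bar>\<Sum>i\<in>{a..<n}. \<chi> i\<bar> \<le> 2 * real Q"
proof (cases "a \<le> n")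
  case True
  have "(\<Sum>i<n. \<chi> i) = (\<Sum>i<a. \<chi> i) + (\<Sum>i\<in>{a..<n}. \<chi> i)"
    using True by (metis atLeast0LessThan le0 sum.atLeastLessThan_concat)
  then show ?thesis using partial_sum_bound[of n] partial_sum_bound[of a] by linarith
qed auto

definition L_partial :: "nat \<Rightarrow> real"
  where "L_partial N = (\<Sum>n\<in>{1..N}. \<chi> n / real n)"

text \<open>The value L(1, \<chi>). The use of \<open>lim\<close> is justified by
  \<open>L_partial_tendsto\<close>.\<close>

definition L :: real
  where "L = lim L_partial"

text \<open>Abel summation against \<open>1 / n\<close>. The explicit rate is what makes the error
  terms in \<open>mangoldt_sum_bounded\<close> summable against Chebyshev's bound.\<close>

lemma L_partial_diff: "M \<le> N \<Longrightarrow> \<bar>L_partial N - L_partial M\<bar> \<le> 2 * real Q / real (Suc M)"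
proof -
  assume "M \<le> N"
  have "{1..N} = {1..M} \<union> {Suc M..<Suc N}" using \<open>M \<le> N\<close> by auto
  then have "L_partial N = L_partial M + (\<Sum>n\<in>{Suc M..<Suc N}. \<chi> n * (1 / real n))"
    unfolding L_partial_def by (subst \<open>{1..N} = _\<close>, subst sum.union_disjoint) auto
  moreover have "\<bar>\<Sum>n\<in>{Suc M..<Suc N}. \<chi> n * (1 / real n)\<bar> \<le> 2 * real Q * (1 / real (Suc M))"
    by (intro Abel_bound interval_sum_bound) (auto simp: field_simps)
  ultimately show ?thesis by simp
qed

lemma L_partial_tendsto: "L_partial \<longlonglongrightarrow> L"
proof -
  have "Cauchy L_partial"
  proof (rule CauchyI)
    fix e :: real assume "e > 0"
    obtain M where M: "2 * real Q / e < real M" using reals_Archimedean2 by blast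
    have less: "\<bar>L_partial n - L_partial m\<bar> < e" if "M \<le> m" "m \<le> n" for m n
    proof -
      have "2 * real Q / real (Suc m) < e"
        using M \<open>e > 0\<close> that(1) by (simp add: field_simps) (smt (verit) mult_left_mono of_nat_mono)
      then show ?thesis using L_partial_diff[OF that(2)] by simp
    qed
    show "\<exists>M. \<forall>m\<ge>M. \<forall>n\<ge>M. norm (L_partial m - L_partial n) < e"
    proof (intro exI[of _ M] allI impI)
      fix m n assume "M \<le> m" "M \<le> n"
      then show "norm (L_partial m - L_partial n) < e"
        using less[of m n] less[of n m] by (cases "m \<le> n") (auto simp: abs_minus_commute)
    qed
  qed
  then show ?thesis unfolding L_def by (simp add: Cauchy_convergent_iff convergent_LIMSEQ_iff)
qed

lemma L_partial_error: "\<bar>L_partial M - L\<bar> \<le> 2 * real Q / real (Suc M)"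
proof -
  have "(\<lambda>N. \<bar>L_partial N - L_partial M\<bar>) \<longlonglongrightarrow> \<bar>L - L_partial M\<bar>"
    by (intro tendsto_intros L_partial_tendsto)
  moreover have "\<forall>\<^sub>F N in sequentially. \<bar>L_partial N - L_partial M\<bar> \<le> 2 * real Q / real (Suc M)"
    using eventually_ge_at_top[of M] by eventually_elim (rule L_partial_diff)
  ultimately have "\<bar>L - L_partial M\<bar> \<le> 2 * real Q / real (Suc M)"
    by (intro tendsto_upperbound) auto
  then show ?thesis by (simp add: abs_minus_commute)
qed

lemma log_sum_bounded: "\<exists>C. \<forall>N. \<bar>\<Sum>n\<in>{1..N}. \<chi> n * (ln (real n) / real n)\<bar> \<le> C"
proof (intro exI allI)
  fix N
  let ?f = "\<lambda>n. \<chi> n * (ln (real n) / real n)"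
  \<comment> \<open>The function \<open>ln x / x\<close> decreases only from e onwards, so Abel
    summation starts at 3 and the terms 1 and 2 are estimated apart.\<close>
  have "\<bar>sum ?f {3..<Suc N}\<bar> \<le> 2 * real Q * (ln (real 3) / real 3)"
  proof (intro Abel_bound interval_sum_bound)
    fix i :: nat assume "3 \<le> i"
    have "3 \<le> real i" using \<open>3 \<le> i\<close> by simp
    then have "exp 1 \<le> real i" using exp_le by linarith
    then show "ln (real (Suc i)) / real (Suc i) \<le> ln (real i) / real i"
      by (intro ln_x_over_x_mono) auto
    show "0 \<le> ln (real i) / real i" using \<open>3 \<le> i\<close> by simp
  qed
  moreover have "\<bar>sum ?f {1..N} - sum ?f {3..<Suc N}\<bar> \<le> ln 2 / 2"
  proof -
    have "{1..N} = {1..N} \<inter> {1, 2} \<union> {3..<Suc N}" by auto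
    then have "sum ?f {1..N} = sum ?f ({1..N} \<inter> {1, 2}) + sum ?f {3..<Suc N}"
      by (subst \<open>{1..N} = _\<close>, subst sum.union_disjoint) auto
    moreover have "\<bar>sum ?f ({1..N} \<inter> {1, 2})\<bar> \<le> ln 2 / 2"
    proof -
      have "\<bar>sum ?f ({1..N} \<inter> {1, 2})\<bar> \<le> (\<Sum>n\<in>{1..N} \<inter> {1, 2}. ln (real n) / real n)"
        using abs_le_1 by (intro order.trans[OF sum_abs] sum_mono)
          (auto simp: abs_mult intro!: mult_left_le_one_le)
      also have "\<dots> \<le> (\<Sum>n\<in>{1, 2}. ln (real n) / real n)" by (intro sum_mono2) auto
      finally show ?thesis by simp
    qed
    ultimately show ?thesis by simp
  qed
  ultimately show "\<bar>sum ?f {1..N}\<bar> \<le> 2 * real Q * (ln (real 3) / real 3) + ln 2 / 2"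
    by linarith
qed

text \<open>As in Mertens' theorem: \<open>ln\<close> is the divisor sum of \<open>mangoldt\<close>,
  so the bounded sum of \<chi>(n) ln(n) / n equals the sum of \<chi>(d) \<Lambda>(d) / d times
  \<open>L_partial (N div d)\<close>. Replacing the last factor by \<open>L\<close> costs a bounded
  amount by Chebyshev, and one divides by \<open>L\<close>.\<close>

lemma mangoldt_sum_bounded:
  assumes "L \<noteq> 0"
  shows "\<exists>C. \<forall>N. \<bar>\<Sum>n\<in>{1..N}. \<chi> n * (mangoldt n / real n)\<bar> \<le> C"
proof -
  obtain C where C: "\<And>N. \<bar>\<Sum>n\<in>{1..N}. \<chi> n * (ln (real n) / real n)\<bar> \<le> C"
    using log_sum_bounded by blast
  have "\<bar>\<Sum>n\<in>{1..N}. \<chi> n * (mangoldt n / real n)\<bar> \<le> (C + 8 * real Q) / \<bar>L\<bar>" for N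
  proof (cases "N = 0")
    case True
    then show ?thesis using C[of 0] by simp
  next
    case False
    have "(\<Sum>n\<in>{1..N}. \<chi> n * (ln (real n) / real n))
        = (\<Sum>n\<in>{1..N}. \<Sum>d | d dvd n. \<chi> d * (mangoldt d / real d) * (\<chi> (n div d) / real (n div d)))"
    proof (intro sum.cong refl)
      fix n assume "n \<in> {1..N}"
      then have "ln (real n) = (\<Sum>d | d dvd n. mangoldt d)" by (simp add: mangoldt_sum)
      then have "\<chi> n * (ln (real n) / real n) = (\<Sum>d | d dvd n. \<chi> n * (mangoldt d / real n))"
        by (simp add: sum_distrib_left sum_divide_distrib)
      also have "\<dots> = (\<Sum>d | d dvd n. \<chi> d * (mangoldt d / real d) * (\<chi> (n div d) / real (n div d)))"
      proof (intro sum.cong refl)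
        fix d assume "d \<in> {d. d dvd n}"
        then obtain j where j: "n = d * j" by auto
        then have "d \<noteq> 0" using \<open>n \<in> {1..N}\<close> by auto
        then show "\<chi> n * (mangoldt d / real n)
            = \<chi> d * (mangoldt d / real d) * (\<chi> (n div d) / real (n div d))"
          by (simp add: j mult)
      qed
      finally show "\<chi> n * (ln (real n) / real n)
        = (\<Sum>d | d dvd n. \<chi> d * (mangoldt d / real d) * (\<chi> (n div d) / real (n div d)))" .
    qed
    also have "\<dots> = (\<Sum>d\<in>{1..N}. \<Sum>j\<in>{1..N div d}. \<chi> d * (mangoldt d / real d) * (\<chi> j / real j))"
      by (rule sum_over_divisors_swap)
    also have "\<dots> = (\<Sum>d\<in>{1..N}. \<chi> d * (mangoldt d / real d) * L_partial (N div d))"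
      by (simp add: L_partial_def sum_distrib_left)
    finally have "(\<Sum>n\<in>{1..N}. \<chi> n * (ln (real n) / real n)) - L * (\<Sum>n\<in>{1..N}. \<chi> n * (mangoldt n / real n))
        = (\<Sum>d\<in>{1..N}. \<chi> d * (mangoldt d / real d) * (L_partial (N div d) - L))"
      by (simp add: sum_distrib_left sum_subtractf[symmetric] algebra_simps diff_divide_distrib)
    also have "\<bar>\<dots>\<bar> \<le> (\<Sum>d\<in>{1..N}. 2 * real Q / real N * mangoldt d)"
    proof (intro order.trans[OF sum_abs] sum_mono)
      fix d assume d: "d \<in> {1..N}"
      \<comment> \<open>This turns the tail error \<open>2 * Q / Suc (N div d)\<close> into
        \<open>2 * Q * d / N\<close>, cancelling the denominator \<open>d\<close>.\<close>
      have "N \<le> d * Suc (N div d)"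
        using d dividend_less_times_div[of d N] by simp
      then have N: "real N \<le> real d * real (Suc (N div d))" by (metis of_nat_le_iff of_nat_mult)
      have "\<bar>\<chi> d * (mangoldt d / real d) * (L_partial (N div d) - L)\<bar>
          \<le> 1 * (mangoldt d / real d) * (2 * real Q / real (Suc (N div d)))"
        unfolding abs_mult using abs_le_1[of d] L_partial_error[of "N div d"] mangoldt_nonneg[of d]
        by (intro mult_mono) auto
      also have "\<dots> = 2 * real Q * mangoldt d / (real d * real (Suc (N div d)))" by simp
      also have "\<dots> \<le> 2 * real Q * mangoldt d / real N"
        using N False mangoldt_nonneg[of d] by (intro divide_left_mono) auto
      finally show "\<bar>\<chi> d * (mangoldt d / real d) * (L_partial (N div d) - L)\<bar>
        \<le> 2 * real Q / real N * mangoldt d" by simp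
    qed
    also have "\<dots> = 2 * real Q / real N * (\<Sum>d\<in>{1..N}. mangoldt d)"
      by (simp only: sum_distrib_left)
    also have "\<dots> \<le> 2 * real Q / real N * (4 * real N)"
      by (intro mult_left_mono Chebyshev_upper_bound) auto
    also have "\<dots> = 8 * real Q" using False by simp
    finally have "\<bar>L * (\<Sum>n\<in>{1..N}. \<chi> n * (mangoldt n / real n))\<bar> \<le> C + 8 * real Q"
      using C[of N] by linarith
    then show ?thesis using assms by (simp add: abs_mult field_simps)
  qed
  then show ?thesis by blast
qed

end

section \<open>Nonvanishing of L(1, \<chi>) by Lambert series\<close>

lemma sum_divisors_mult_coprime:
  fixes f :: "nat \<Rightarrow> 'a :: comm_semiring_1"
  assumes "coprime a b" and f: "\<And>m n. f (m * n) = f m * f n"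
  shows "(\<Sum>d | d dvd a * b. f d) = (\<Sum>d | d dvd a. f d) * (\<Sum>d | d dvd b. f d)"
proof -
  have image: "{d. d dvd a * b} = (\<lambda>(d, e). d * e) ` ({d. d dvd a} \<times> {e. e dvd b})"
  proof (intro equalityI subsetI)
    fix d assume "d \<in> {d. d dvd a * b}"
    then obtain x y where "d = x * y" "x dvd a" "y dvd b" by (auto elim: dvd_productE)
    then show "d \<in> (\<lambda>(d, e). d * e) ` ({d. d dvd a} \<times> {e. e dvd b})" by auto
  qed (auto intro: mult_dvd_mono)
  have "inj_on (\<lambda>(d, e). d * e) ({d. d dvd a} \<times> {e. e dvd b})"
  proof (rule inj_onI, clarify)
    fix d e d' e' assume *: "d dvd a" "e dvd b" "d' dvd a" "e' dvd b" "d * e = d' * e'"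
    have "coprime d e'" "coprime d' e" using assms(1) * by (meson coprime_divisors)+
    then show "d = d' \<and> e = e'" using *(5) coprime_crossproduct_nat by blast
  qed
  then have "(\<Sum>d | d dvd a * b. f d) = (\<Sum>(d, e)\<in>{d. d dvd a} \<times> {e. e dvd b}. f d * f e)"
    unfolding image by (subst sum.reindex) (auto simp: f case_prod_unfold intro!: sum.cong)
  then show ?thesis by (simp add: sum_product sum.cartesian_product)
qed

context real_character
begin

text \<open>The Dirichlet convolution of \<chi> with 1, giving the power series coefficients of the
  Lambert series of \<chi>.\<close>

definition divisor_sum :: "nat \<Rightarrow> real"
  where "divisor_sum n = (\<Sum>d | d dvd n. \<chi> d)"

lemma divisor_sum_mult_coprime:
  "coprime a b \<Longrightarrow> divisor_sum (a * b) = divisor_sum a * divisor_sum b"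
  unfolding divisor_sum_def by (rule sum_divisors_mult_coprime) (auto simp: mult)

lemma divisor_sum_prime_power:
  assumes "prime p"
  shows "divisor_sum (p ^ k) = (\<Sum>i\<le>k. \<chi> p ^ i)"
proof -
  have "{d. d dvd p ^ k} = (\<lambda>i. p ^ i) ` {..k}"
    using divides_primepow_nat[OF assms, of _ k] by auto
  moreover have "inj_on (\<lambda>i. p ^ i) {..k}"
    using assms prime_gt_1_nat by (intro inj_onI) (simp add: power_inject_exp)
  ultimately show ?thesis
    unfolding divisor_sum_def by (simp add: sum.reindex power)
qed

lemma geometric_sum_sign:
  assumes "x \<in> {-1, 0, 1 :: real}"
  shows "0 \<le> (\<Sum>i\<le>k. x ^ i)" "even k \<Longrightarrow> 1 \<le> (\<Sum>i\<le>k. x ^ i)"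
proof -
  have "x = 0 \<or> x = 1 \<or> x = -1" using assms by auto
  moreover have "(\<Sum>i\<le>k. (-1 :: real) ^ i) = (if even k then 1 else 0)" by (induction k) auto
  moreover have "(\<Sum>i\<le>k. (0 :: real) ^ i) = 1" by (induction k) auto
  ultimately show "0 \<le> (\<Sum>i\<le>k. x ^ i)" "even k \<Longrightarrow> 1 \<le> (\<Sum>i\<le>k. x ^ i)" by auto
qed

text \<open>By multiplicativity each exact prime power \<open>p ^ k\<close> contributes the factor 1
  + \<chi>(p) + ... + \<chi>(p)^k, which is nonnegative, and at least 1 for even \<open>k\<close>.
  Removing such a power from a square leaves a square, so both claims go through one
  induction.\<close>

lemma divisor_sum_sign:
  assumes "n > 0"
  shows "0 \<le> divisor_sum n \<and> ((\<exists>m. n = m\<^sup>2) \<longrightarrow> 1 \<le> divisor_sum n)"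
  using assms
proof (induction n rule: less_induct)
  case (less n)
  show ?case
  proof (cases "n = 1")
    case True
    then show ?thesis using one by (simp add: divisor_sum_def)
  next
    case False
    obtain p where p: "prime p" "p dvd n" using prime_factor_nat[OF False] by blast
    define k where "k = multiplicity p n"
    obtain m where m: "n = p ^ k * m" "\<not> p dvd m"
      using multiplicity_decompose'[of n p] less.prems p(1) unfolding k_def by (metis not_prime_unit neq0_conv)
    have "k > 0" using p less.prems by (simp add: k_def prime_multiplicity_gt_zero_iff)
    have "m > 0" using m less.prems by (intro Nat.gr0I) auto
    have "1 < p ^ k" using prime_gt_1_nat[OF p(1)] \<open>k > 0\<close> by (rule one_less_power)
    then have "m < n" using m \<open>m > 0\<close> by simp
    note IH = less.IH[OF \<open>m < n\<close> \<open>m > 0\<close>]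
    have "coprime (p ^ k) m" using p(1) m(2) by (simp add: prime_imp_coprime)
    then have n: "divisor_sum n = (\<Sum>i\<le>k. \<chi> p ^ i) * divisor_sum m"
      using m(1) p(1) by (simp add: divisor_sum_mult_coprime divisor_sum_prime_power)
    have "1 \<le> divisor_sum n" if "n = l\<^sup>2" for l
    proof -
      have "l \<noteq> 0" using that less.prems by auto
      then have k: "k = 2 * multiplicity p l"
        using that p(1) by (simp add: k_def prime_elem_multiplicity_power_distrib)
      obtain l' where l': "l = p ^ multiplicity p l * l'"
        using multiplicity_dvd by (metis dvdE)
      have "p ^ k * m = p ^ k * l'\<^sup>2"
        using that m(1) k l' by (metis power_mult power_mult_distrib mult.commute)
      then have "m = l'\<^sup>2" using p(1) by simp
      then have "1 \<le> divisor_sum m" using IH by blast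
      moreover have "1 \<le> (\<Sum>i\<le>k. \<chi> p ^ i)" using k range by (intro geometric_sum_sign) auto
      ultimately show ?thesis unfolding n using mult_mono[of 1 _ 1] by fastforce
    qed
    moreover have "0 \<le> divisor_sum n"
      unfolding n using IH geometric_sum_sign(1)[OF range] by simp
    ultimately show ?thesis by blast
  qed
qed

end

text \<open>Each of the \<open>n\<close> terms of 1 + t + ... + t^(n-1) is at least
  \<open>t ^ n\<close>. This makes Monsky's weights nonnegative.\<close>

lemma geometric_sum_lower_bound:
  fixes t :: real
  assumes "0 < t" "t < 1"
  shows "real n * t ^ n * (1 - t) \<le> 1 - t ^ n"
proof -
  have "real n * t ^ n = (\<Sum>i<n. t ^ n)" by simp
  also have "\<dots> \<le> (\<Sum>i<n. t ^ i)"
    using assms by (intro sum_mono power_decreasing) auto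
  finally have "real n * t ^ n * (1 - t) \<le> (\<Sum>i<n. t ^ i) * (1 - t)"
    using assms by (intro mult_right_mono) auto
  then show ?thesis using one_diff_power_eq[of t n] by (simp add: mult.commute)
qed

text \<open>
  Monsky's weights. That they decrease amounts to
  \<open>n * (n + 1) * t ^ n \<le> (1 + t + \<dots> + t ^ (n - 1)) * (1 + t + \<dots> + t ^ n)\<close>.
\<close>
definition Monsky_weight :: "real \<Rightarrow> nat \<Rightarrow> real"
  where "Monsky_weight t n = 1 / (real n * (1 - t)) - t ^ n / (1 - t ^ n)"

text \<open>Pair \<open>t ^ i\<close> with \<open>t ^ (n - i)\<close>: their geometric mean is
  \<open>sqrt t ^ n\<close> for every \<open>i\<close>.\<close>

lemma geometric_sum_AM_GM:
  fixes t :: real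
  assumes "t > 0"
  shows "real (Suc n) ^ 2 * t ^ n \<le> (\<Sum>i\<le>n. t ^ i) ^ 2"
proof -
  define s where "s = sqrt t"
  have s: "t = s\<^sup>2" "s > 0" using assms by (simp_all add: s_def)
  have rev: "(\<Sum>i\<le>n. t ^ i) = (\<Sum>i\<le>n. t ^ (n - i))"
    by (rule sum.reindex_bij_witness[of _ "\<lambda>i. n - i" "\<lambda>i. n - i"]) auto
  have "2 * (real (Suc n) * s ^ n) = (\<Sum>i\<le>n. 2 * s ^ n)" by simp
  also have "\<dots> \<le> (\<Sum>i\<le>n. t ^ i + t ^ (n - i))"
  proof (intro sum_mono)
    fix i assume "i \<in> {..n}"
    then have "s ^ n = s ^ i * s ^ (n - i)" by (simp add: power_add[symmetric])
    moreover have "0 \<le> (s ^ i - s ^ (n - i))\<^sup>2" by simp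
    moreover have "t ^ j = (s ^ j)\<^sup>2" for j unfolding s(1) by (simp add: power_mult[symmetric] mult.commute)
    ultimately show "2 * s ^ n \<le> t ^ i + t ^ (n - i)" by (simp add: power2_diff)
  qed
  also have "\<dots> = 2 * (\<Sum>i\<le>n. t ^ i)" using rev by (simp add: sum.distrib)
  finally have "real (Suc n) * s ^ n \<le> (\<Sum>i\<le>n. t ^ i)" by simp
  then have "(real (Suc n) * s ^ n)\<^sup>2 \<le> (\<Sum>i\<le>n. t ^ i)\<^sup>2" using s by (intro power_mono) auto
  then show ?thesis by (simp add: s(1) power_mult_distrib power_mult[symmetric] mult.commute)
qed

lemma one_minus_power_eq_geometric_sum:
  fixes t :: real
  shows "1 - t ^ Suc n = (1 - t) * (\<Sum>i\<le>n. t ^ i)"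
  using one_diff_power_eq[of t "Suc n"] by (simp add: lessThan_Suc_atMost)

lemma Monsky_weight_antitone:
  assumes "0 < t" "t < 1" "n \<ge> 1"
  shows "Monsky_weight t (Suc n) \<le> Monsky_weight t n"
proof -
  obtain m where m: "n = Suc m" using assms(3) by (cases n) auto
  define g where "g = (\<Sum>i\<le>m. t ^ i)"
  define h where "h = (\<Sum>i\<le>n. t ^ i)"
  have g: "1 - t ^ n = (1 - t) * g" and h: "1 - t ^ Suc n = (1 - t) * h"
    unfolding g_def h_def m by (rule one_minus_power_eq_geometric_sum)+
  have pos: "0 < g" "0 < h" unfolding g_def h_def using assms(1) by (auto intro!: sum_pos)
  \<comment> \<open>The inequality is proved in squared form: one factor \<open>t\<close> is dropped
    from \<open>t ^ n * t ^ n\<close>, and then AM-GM applies to \<open>g\<close> and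
    \<open>h\<close> separately.\<close>
  have "(real n * real (Suc n) * t ^ n)\<^sup>2 = (real n)\<^sup>2 * (real (Suc n))\<^sup>2 * (t ^ n * t ^ n)"
    by (simp add: power2_eq_square)
  also have "\<dots> \<le> (real n)\<^sup>2 * (real (Suc n))\<^sup>2 * (t ^ m * t ^ n)"
    using assms m by (intro mult_left_mono mult_right_mono) (auto intro: mult_left_le_one_le)
  also have "\<dots> = ((real (Suc m))\<^sup>2 * t ^ m) * ((real (Suc n))\<^sup>2 * t ^ n)" by (simp add: m)
  also have "\<dots> \<le> g\<^sup>2 * h\<^sup>2"
    unfolding g_def h_def using assms(1) by (intro mult_mono geometric_sum_AM_GM) auto
  also have "\<dots> = (g * h)\<^sup>2" by (simp add: power_mult_distrib)
  finally have le: "real n * real (Suc n) * t ^ n \<le> g * h"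
    by (rule power2_le_imp_le) (use pos in auto)
  have "t ^ Suc n / (1 - t ^ Suc n) - t ^ n / (1 - t ^ n) = (t ^ Suc n * (1 - t ^ n) - t ^ n * (1 - t ^ Suc n)) / ((1 - t ^ Suc n) * (1 - t ^ n))"
    by (rule diff_frac_eq) (use assms pos in \<open>simp_all add: g h del: power_Suc\<close>)
  also have "\<dots> = - (t ^ n / ((1 - t) * (g * h)))"
  proof -
    have "t ^ Suc n * (1 - t ^ n) - t ^ n * (1 - t ^ Suc n) = - (t ^ n) * (1 - t)"
      by (simp add: algebra_simps)
    note num = this
    have "(- x * u) / ((u * h) * (u * g)) = - (x / (u * (g * h)))" if "u \<noteq> 0" for x u :: real
      using that pos by (simp add: field_simps)
    then show ?thesis unfolding num unfolding g h using assms by simp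
  qed
  finally have diff1: "t ^ Suc n / (1 - t ^ Suc n) - t ^ n / (1 - t ^ n) = - (t ^ n / ((1 - t) * (g * h)))" .
  have diff2: "1 / (real n * (1 - t)) - 1 / (real (Suc n) * (1 - t)) = 1 / ((1 - t) * (real n * real (Suc n)))"
  proof -
    have "1 / (x * u) - 1 / ((x + 1) * u) = 1 / (u * (x * (x + 1)))" if "x > 0" "u \<noteq> 0" for x u :: real
      using that by (simp add: divide_simps)
    from this[of "real n" "1 - t"] show ?thesis using assms by (simp add: add.commute)
  qed
  have "x / y \<le> 1 / z" if "z * x \<le> y" "0 < y" "0 < z" for x y z :: real
    using that by (simp add: field_simps)
  then have "t ^ n / (g * h) \<le> 1 / (real n * real (Suc n))"
    using le pos assms by simp
  then have "t ^ n / (g * h) / (1 - t) \<le> 1 / (real n * real (Suc n)) / (1 - t)"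
    using assms by (intro divide_right_mono) auto
  then have "t ^ n / ((1 - t) * (g * h)) \<le> 1 / ((1 - t) * (real n * real (Suc n)))"
    by (simp add: mult.commute)
  then show ?thesis using diff1 diff2 unfolding Monsky_weight_def by linarith
qed

lemma Monsky_weight_nonneg:
  assumes "0 < t" "t < 1" "n \<ge> 1"
  shows "0 \<le> Monsky_weight t n"
proof -
  have "t ^ n < 1" using assms by (simp add: power_Suc_less_one power_less_one_iff)
  then have "t ^ n / (1 - t ^ n) \<le> 1 / (real n * (1 - t))"
    using geometric_sum_lower_bound[OF assms(1,2), of n] assms by (simp add: field_simps)
  then show ?thesis by (simp add: Monsky_weight_def)
qed

text \<open>The tail of the geometric series in \<open>t ^ d\<close> starts at an exponent that is
  at least \<open>N\<close>, and \<open>1 - t ^ d \<ge> 1 - t\<close>.\<close>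

lemma Lambert_remainder:
  fixes t :: real
  assumes "0 < t" "t < 1" "d \<ge> 1" "d \<le> N"
  shows "\<bar>t ^ d / (1 - t ^ d) - (\<Sum>j\<in>{1..N div d}. t ^ (d * j))\<bar> \<le> t ^ N / (1 - t)"
proof -
  define J where "J = N div d"
  have td: "t ^ d \<le> t" "0 < t ^ d" using assms power_decreasing[of 1 d t] by auto
  then have "t ^ d < 1" using assms by linarith
  have "(\<Sum>j\<in>{1..J}. t ^ (d * j)) * (1 - t ^ d) = t ^ d - t ^ (d * Suc J)"
  proof (induction J)
    case (Suc J)
    have "(\<Sum>j\<in>{1..Suc J}. t ^ (d * j)) * (1 - t ^ d)
        = (\<Sum>j\<in>{1..J}. t ^ (d * j)) * (1 - t ^ d) + t ^ (d * Suc J) * (1 - t ^ d)"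
      by (simp add: distrib_right)
    also have "\<dots> = t ^ d - t ^ (d * Suc (Suc J))"
      unfolding Suc.IH by (simp add: algebra_simps power_add)
    finally show ?case .
  qed simp
  then have "(\<Sum>j\<in>{1..J}. t ^ (d * j)) = (t ^ d - t ^ (d * Suc J)) / (1 - t ^ d)"
    using \<open>t ^ d < 1\<close> by (simp add: field_simps)
  then have "t ^ d / (1 - t ^ d) - (\<Sum>j\<in>{1..J}. t ^ (d * j)) = t ^ (d * Suc J) / (1 - t ^ d)"
    by (simp add: diff_divide_distrib)
  moreover have "t ^ (d * Suc J) / (1 - t ^ d) \<le> t ^ N / (1 - t)"
  proof (intro frac_le power_decreasing)
    show "N \<le> d * Suc J" using assms(3) dividend_less_times_div[of d N] by (simp add: J_def)
  qed (use assms td in auto)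
  moreover have "0 \<le> t ^ (d * Suc J) / (1 - t ^ d)" using \<open>t ^ d < 1\<close> assms by simp
  ultimately show ?thesis unfolding J_def[symmetric] by linarith
qed

context real_character
begin

text \<open>All coefficients are nonnegative, so it suffices to keep the squares, where they are at
  least 1.\<close>

lemma divisor_sum_power_lower_bound:
  assumes "0 < t" "K\<^sup>2 \<le> N"
  shows "(\<Sum>k\<in>{1..K}. t ^ k\<^sup>2) \<le> (\<Sum>n\<in>{1..N}. divisor_sum n * t ^ n)"
proof -
  have "(\<Sum>k\<in>{1..K}. t ^ k\<^sup>2) = (\<Sum>n\<in>(\<lambda>k. k\<^sup>2) ` {1..K}. t ^ n)"
    by (subst sum.reindex) (auto simp: inj_on_def)
  also have "\<dots> \<le> (\<Sum>n\<in>(\<lambda>k. k\<^sup>2) ` {1..K}. divisor_sum n * t ^ n)"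
  proof (intro sum_mono)
    fix n assume "n \<in> (\<lambda>k. k\<^sup>2) ` {1..K}"
    then have "1 \<le> divisor_sum n" using divisor_sum_sign[of n] by auto
    then show "t ^ n \<le> divisor_sum n * t ^ n" using assms(1) by simp
  qed
  also have "\<dots> \<le> (\<Sum>n\<in>{1..N}. divisor_sum n * t ^ n)"
  proof (intro sum_mono2)
    show "(\<lambda>k. k\<^sup>2) ` {1..K} \<subseteq> {1..N}"
      using assms(2) by (auto intro: order.trans[OF power_mono])
    fix n assume "n \<in> {1..N} - (\<lambda>k. k\<^sup>2) ` {1..K}"
    then show "0 \<le> divisor_sum n * t ^ n" using divisor_sum_sign[of n] assms(1) by auto
  qed auto
  finally show ?thesis .
qed

text \<open>Up to truncation the sum is the Lambert series \<open>A\<close>. Each term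
  \<open>t ^ d / (1 - t ^ d)\<close> is \<open>1 / (d * (1 - t))\<close> minus Monsky's weight; the
  first part sums to \<open>L_partial N / (1 - t)\<close>, and the weights decrease from 1, so Abel
  summation bounds the rest by \<open>2 * Q\<close>.\<close>

lemma divisor_sum_power_upper_bound:
  assumes "0 < t" "t < 1"
  shows "(\<Sum>n\<in>{1..N}. divisor_sum n * t ^ n) \<le>
    2 * real Q + \<bar>L_partial N\<bar> / (1 - t) + real N * t ^ N / (1 - t)"
proof -
  define A where "A = (\<Sum>d\<in>{1..N}. \<chi> d * (t ^ d / (1 - t ^ d)))"
  have "(\<Sum>n\<in>{1..N}. divisor_sum n * t ^ n) = (\<Sum>n\<in>{1..N}. \<Sum>d | d dvd n. \<chi> d * t ^ (d * (n div d)))"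
    unfolding divisor_sum_def sum_distrib_right by (intro sum.cong) auto
  also have "\<dots> = (\<Sum>d\<in>{1..N}. \<Sum>j\<in>{1..N div d}. \<chi> d * t ^ (d * j))"
    by (rule sum_over_divisors_swap)
  finally have D: "(\<Sum>n\<in>{1..N}. divisor_sum n * t ^ n)
      = (\<Sum>d\<in>{1..N}. \<chi> d * (\<Sum>j\<in>{1..N div d}. t ^ (d * j)))"
    by (simp add: sum_distrib_left)
  have "\<bar>A - (\<Sum>n\<in>{1..N}. divisor_sum n * t ^ n)\<bar> \<le> (\<Sum>d\<in>{1..N}. t ^ N / (1 - t))"
    unfolding D A_def sum_subtractf[symmetric] right_diff_distrib[symmetric]
  proof (intro order.trans[OF sum_abs] sum_mono)
    fix d assume "d \<in> {1..N}"
    then have "\<bar>\<chi> d\<bar> * \<bar>t ^ d / (1 - t ^ d) - (\<Sum>j\<in>{1..N div d}. t ^ (d * j))\<bar> \<le> 1 * (t ^ N / (1 - t))"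
      using assms abs_le_1 by (intro mult_mono Lambert_remainder) auto
    then show "\<bar>\<chi> d * (t ^ d / (1 - t ^ d) - (\<Sum>j\<in>{1..N div d}. t ^ (d * j)))\<bar> \<le> t ^ N / (1 - t)"
      by (simp only: abs_mult mult_1)
  qed
  then have 1: "\<bar>A - (\<Sum>n\<in>{1..N}. divisor_sum n * t ^ n)\<bar> \<le> real N * t ^ N / (1 - t)" by simp
  have "(\<Sum>n\<in>{1..<Suc N}. \<chi> n * Monsky_weight t n) = L_partial N / (1 - t) - A"
    unfolding A_def L_partial_def Monsky_weight_def atLeastLessThanSuc_atLeastAtMost
      sum_divide_distrib sum_subtractf[symmetric]
    by (intro sum.cong refl) (simp add: algebra_simps)
  moreover have "\<bar>\<Sum>n\<in>{1..<Suc N}. \<chi> n * Monsky_weight t n\<bar> \<le> 2 * real Q * Monsky_weight t 1"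
    using assms by (intro Abel_bound interval_sum_bound Monsky_weight_antitone Monsky_weight_nonneg)
  moreover have "Monsky_weight t 1 = 1"
    using assms by (simp add: Monsky_weight_def diff_divide_distrib[symmetric])
  ultimately have "\<bar>L_partial N / (1 - t) - A\<bar> \<le> 2 * real Q" by simp
  moreover have "\<bar>L_partial N / (1 - t)\<bar> = \<bar>L_partial N\<bar> / (1 - t)" using assms by simp
  ultimately show ?thesis using 1 by linarith
qed

text \<open>If \<open>L = 0\<close>, the upper bound tends to \<open>2 * Q\<close> as
  \<open>N\<close> grows, for every fixed \<open>t\<close>, whereas the squares alone contribute
  arbitrarily much as \<open>t\<close> approaches 1.\<close>

theorem L_nonzero: "L \<noteq> 0"
proof
  assume "L = 0"
  \<comment> \<open>By Bernoulli's inequality this \<open>t\<close> makes each of the first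
    \<open>K\<close> square terms at least 1/2, and \<open>K / 2\<close> exceeds
    \<open>2 * Q + 1\<close>.\<close>
  define K where "K = 4 * Q + 3"
  define t where "t = 1 - 1 / (2 * real K ^ 2)"
  have "0 < K" by (simp add: K_def)
  then have K1: "1 \<le> real K ^ 2" by simp
  then have "1 / (2 * real K ^ 2) \<le> 1 / 2" using \<open>0 < K\<close> by (intro divide_left_mono) auto
  moreover have "0 < 1 / (2 * real K ^ 2)" using K1 \<open>0 < K\<close> by (intro divide_pos_pos) auto
  ultimately have t: "0 < t" "t < 1" unfolding t_def by linarith+
  have "(\<lambda>N. 2 * real Q + \<bar>L_partial N\<bar> / (1 - t) + real N * t ^ N / (1 - t))
      \<longlonglongrightarrow> 2 * real Q + \<bar>L\<bar> / (1 - t) + 0 / (1 - t)"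
    using t by (intro tendsto_intros L_partial_tendsto powser_times_n_limit_0) auto
  then have "\<forall>\<^sub>F N in sequentially.
      2 * real Q + \<bar>L_partial N\<bar> / (1 - t) + real N * t ^ N / (1 - t) < 2 * real Q + 1"
    by (rule order_tendstoD) (simp add: \<open>L = 0\<close>)
  then have "\<forall>\<^sub>F N in sequentially. K\<^sup>2 \<le> N \<and>
      2 * real Q + \<bar>L_partial N\<bar> / (1 - t) + real N * t ^ N / (1 - t) < 2 * real Q + 1"
    using eventually_ge_at_top[of "K\<^sup>2"] by eventually_elim simp
  then obtain N where N: "K\<^sup>2 \<le> N"
      "2 * real Q + \<bar>L_partial N\<bar> / (1 - t) + real N * t ^ N / (1 - t) < 2 * real Q + 1"
    by (auto dest: eventually_happens)
  have "real K / 2 = (\<Sum>k\<in>{1..K}. 1 / 2)" by simp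
  also have "\<dots> \<le> (\<Sum>k\<in>{1..K}. t ^ k\<^sup>2)"
  proof (intro sum_mono)
    fix k assume "k \<in> {1..K}"
    then have "real (k\<^sup>2) \<le> real K ^ 2" by (simp add: power_mono)
    then have "real (k\<^sup>2) * (1 / (2 * real K ^ 2)) \<le> real K ^ 2 * (1 / (2 * real K ^ 2))"
      by (intro mult_right_mono) auto
    also have "\<dots> = 1 / 2" using \<open>0 < K\<close> by simp
    finally have "1 / 2 \<le> 1 + real (k\<^sup>2) * (- (1 / (2 * real K ^ 2)))" by simp
    also have "\<dots> \<le> (1 + - (1 / (2 * real K ^ 2))) ^ k\<^sup>2"
      using t by (intro Bernoulli_inequality) (simp add: t_def)
    finally show "1 / 2 \<le> t ^ k\<^sup>2" by (simp add: t_def)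
  qed
  also have "\<dots> \<le> (\<Sum>n\<in>{1..N}. divisor_sum n * t ^ n)"
    using t(1) N(1) by (rule divisor_sum_power_lower_bound)
  also have "\<dots> < 2 * real Q + 1"
    using divisor_sum_power_upper_bound[OF t, of N] N(2) by linarith
  finally show False by (simp add: K_def)
qed

end

section \<open>Prime powers with prescribed character values\<close>

text \<open>A geometric series with ratio \<open>1 / p \<le> 1 / 2\<close>; it shows that finitely
  many exceptional primes contribute a bounded amount.\<close>

lemma sum_mangoldt_prime_powers_bound:
  assumes "prime p"
  shows "(\<Sum>n\<in>{n\<in>{1..N}. \<exists>k>0. n = p ^ k}. mangoldt n / real n) \<le> ln (real p)"
proof -
  have p: "p \<ge> 2" using assms by (rule prime_ge_2_nat)
  have "{n\<in>{1..N}. \<exists>k>0. n = p ^ k} \<subseteq> (\<lambda>k. p ^ k) ` {1..N}"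
  proof
    fix n assume "n \<in> {n\<in>{1..N}. \<exists>k>0. n = p ^ k}"
    then obtain k where k: "k > 0" "n = p ^ k" "p ^ k \<le> N" by auto
    moreover have "k < p ^ k" using p less_exp power_mono[of 2 p k] by (meson le0 less_le_trans)
    ultimately show "n \<in> (\<lambda>k. p ^ k) ` {1..N}" by auto
  qed
  then have "(\<Sum>n\<in>{n\<in>{1..N}. \<exists>k>0. n = p ^ k}. mangoldt n / real n)
      \<le> (\<Sum>n\<in>(\<lambda>k. p ^ k) ` {1..N}. mangoldt n / real n)"
    by (intro sum_mono2) (auto simp: mangoldt_nonneg)
  also have "\<dots> = (\<Sum>k\<in>{1..N}. ln (real p) / real (p ^ k))"
    using p assms by (subst sum.reindex) (auto simp: inj_on_def)
  also have "\<dots> \<le> (\<Sum>k\<in>{1..N}. ln (real p) * (1 / 2) ^ k)"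
  proof (intro sum_mono)
    fix k assume "k \<in> {1..N}"
    have "(2 :: real) ^ k \<le> real p ^ k" using p by (intro power_mono) auto
    then have "1 / real (p ^ k) \<le> (1 / 2) ^ k" by (simp add: power_one_over frac_le)
    then show "ln (real p) / real (p ^ k) \<le> ln (real p) * (1 / 2) ^ k"
      using p mult_left_mono[of "1 / real (p ^ k)" "(1 / 2) ^ k" "ln (real p)"] by simp
  qed
  also have "\<dots> = ln (real p) * (\<Sum>k\<in>{1..N}. (1 / 2) ^ k)" by (simp only: sum_distrib_left)
  also have "\<dots> \<le> ln (real p) * 1"
  proof (intro mult_left_mono)
    have "(\<Sum>k\<in>{1..N}. (1 / 2 :: real) ^ k) = 1 - (1 / 2) ^ N" by (induction N) auto
    then show "(\<Sum>k\<in>{1..N}. (1 / 2 :: real) ^ k) \<le> 1" by simp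
  qed (use p in simp)
  finally show ?thesis by simp
qed

text \<open>If the pattern never occurred, the product \<open>P\<close> of the factors 1 +
  \<epsilon> \<chi>(n) would vanish at all positive powers of primes outside \<open>W\<close>, so
  the sum of \<Lambda>(n) P(n) / n would stay bounded. Expanding \<open>P\<close> shows that it
  differs boundedly from the divergent sum of \<Lambda>(n) / n. Allowing prime powers lets \<Lambda>
  be used directly.\<close>

theorem exists_prime_power_with_signs:
  fixes \<chi> :: "'i \<Rightarrow> nat \<Rightarrow> real" and \<epsilon> :: "'i \<Rightarrow> real"
  assumes fin: "finite I" "finite W" and W: "\<And>p. p \<in> W \<Longrightarrow> prime p"
    and char: "\<And>S. S \<subseteq> I \<Longrightarrow> S \<noteq> {} \<Longrightarrow> \<exists>Q. real_character (\<lambda>n. \<Prod>i\<in>S. \<chi> i n) Q"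
    and nonzero: "\<And>i p. i \<in> I \<Longrightarrow> prime p \<Longrightarrow> p \<notin> W \<Longrightarrow> \<chi> i p \<noteq> 0"
    and \<epsilon>: "\<And>i. i \<in> I \<Longrightarrow> \<epsilon> i \<in> {-1, 1}"
  shows "\<exists>p k. prime p \<and> k > 0 \<and> (\<forall>i\<in>I. \<chi> i (p ^ k) = \<epsilon> i)"
proof (rule ccontr)
  assume "\<not> ?thesis"
  then have none: "\<exists>i\<in>I. \<chi> i (p ^ k) \<noteq> \<epsilon> i" if "prime p" "k > 0" for p k
    using that by blast
  \<comment> \<open>Where all characters are nonzero this is \<open>2 ^ card I\<close> times the
    indicator of the desired signs.\<close>
  define P where "P n = (\<Prod>i\<in>I. 1 + \<epsilon> i * \<chi> i n)" for n
  have single: "\<exists>Q. real_character (\<chi> i) Q" if "i \<in> I" for i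
    using char[of "{i}"] that by simp
  have val: "\<chi> i n \<in> {-1, 0, 1}" if "i \<in> I" for i n
    using single[OF that] real_character.range by blast
  have pow: "\<chi> i (n ^ k) = \<chi> i n ^ k" if "i \<in> I" for i n k
    using single[OF that] real_character.power by blast
  have factor: "0 \<le> 1 + \<epsilon> i * \<chi> i n" "1 + \<epsilon> i * \<chi> i n \<le> 2" if "i \<in> I" for i n
    using val[OF that, of n] \<epsilon>[OF that] by auto
  have P_nonneg: "0 \<le> P n" for n unfolding P_def by (intro prod_nonneg factor)
  have P_le: "P n \<le> 2 ^ card I" for n
  proof -
    have "P n \<le> (\<Prod>i\<in>I. 2)" unfolding P_def using factor by (intro prod_mono) auto
    then show ?thesis by simp
  qed
  have P_zero: "P (p ^ k) = 0" if p: "prime p" "k > 0" "p \<notin> W" for p k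
  proof -
    obtain i where i: "i \<in> I" "\<chi> i (p ^ k) \<noteq> \<epsilon> i" using none p by blast
    have "\<chi> i (p ^ k) \<noteq> 0" using nonzero[OF i(1) p(1,3)] pow[OF i(1)] by simp
    then have "1 + \<epsilon> i * \<chi> i (p ^ k) = 0" using val[OF i(1), of "p ^ k"] \<epsilon>[OF i(1)] i(2) by auto
    then show ?thesis unfolding P_def using i(1) fin(1) by (intro prod_zero) auto
  qed
  define U where "U = 2 ^ card I * (\<Sum>p\<in>W. ln (real p))"
  have upper: "(\<Sum>n\<in>{1..N}. mangoldt n / real n * P n) \<le> U" for N
  proof -
    have "mangoldt n / real n * P n
        \<le> 2 ^ card I * (\<Sum>p\<in>W. if \<exists>k>0. n = p ^ k then mangoldt n / real n else 0)" for n
    proof (cases "\<exists>p\<in>W. \<exists>k>0. n = p ^ k")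
      case True
      then obtain p where p: "p \<in> W" "\<exists>k>0. n = p ^ k" by blast
      have "mangoldt n / real n = (if \<exists>k>0. n = p ^ k then mangoldt n / real n else 0)"
        using p(2) by simp
      also have "\<dots> \<le> (\<Sum>p\<in>W. if \<exists>k>0. n = p ^ k then mangoldt n / real n else 0)"
        using p(1) fin(2) by (intro member_le_sum) (auto simp: mangoldt_nonneg)
      finally have "mangoldt n / real n * P n \<le>
          (\<Sum>p\<in>W. if \<exists>k>0. n = p ^ k then mangoldt n / real n else 0) * 2 ^ card I"
        using P_le P_nonneg by (intro mult_mono) (auto intro!: sum_nonneg simp: mangoldt_nonneg)
      then show ?thesis by (simp add: mult.commute)
    next
      case False
      have "mangoldt n / real n * P n = 0"
      proof (cases "primepow n")
        case True
        then obtain p k where *: "prime p" "k > 0" "n = p ^ k" unfolding primepow_def by auto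
        then have "p \<notin> W" using False by blast
        then show ?thesis using * P_zero by simp
      qed (simp add: mangoldt_def)
      then show ?thesis by (auto intro!: mult_nonneg_nonneg sum_nonneg simp: mangoldt_nonneg)
    qed
    then have "(\<Sum>n\<in>{1..N}. mangoldt n / real n * P n)
        \<le> (\<Sum>n\<in>{1..N}. 2 ^ card I * (\<Sum>p\<in>W. if \<exists>k>0. n = p ^ k then mangoldt n / real n else 0))"
      by (intro sum_mono)
    also have "\<dots> = 2 ^ card I * (\<Sum>p\<in>W. \<Sum>n\<in>{1..N}. if \<exists>k>0. n = p ^ k then mangoldt n / real n else 0)"
      by (subst sum.swap) (simp only: sum_distrib_left)
    also have "\<dots> = 2 ^ card I * (\<Sum>p\<in>W. \<Sum>n\<in>{n\<in>{1..N}. \<exists>k>0. n = p ^ k}. mangoldt n / real n)"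
      by (simp only: sum.inter_filter finite_atLeastAtMost)
    also have "\<dots> \<le> U" unfolding U_def
      by (intro mult_left_mono sum_mono sum_mangoldt_prime_powers_bound W) auto
    finally show ?thesis .
  qed
  \<comment> \<open>The share of the subset \<open>S\<close> in the expansion of \<open>P\<close>.
    The empty set gives the main term; for every other \<open>S\<close> the product is itself a
    character, with nonzero L-value.\<close>
  define X where "X S N = (\<Prod>i\<in>S. \<epsilon> i) * (\<Sum>n\<in>{1..N}. (\<Prod>i\<in>S. \<chi> i n) * (mangoldt n / real n))" for S N
  have "\<exists>C. \<forall>N. \<bar>X S N\<bar> \<le> C" if S: "S \<in> Pow I - {{}}" for S
  proof -
    obtain Q where "real_character (\<lambda>n. \<Prod>i\<in>S. \<chi> i n) Q" using char[of S] S by auto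
    then interpret S: real_character "\<lambda>n. \<Prod>i\<in>S. \<chi> i n" Q .
    obtain C where C: "\<And>N. \<bar>\<Sum>n\<in>{1..N}. (\<Prod>i\<in>S. \<chi> i n) * (mangoldt n / real n)\<bar> \<le> C"
      using S.mangoldt_sum_bounded[OF S.L_nonzero] by blast
    have "\<bar>\<Prod>i\<in>S. \<epsilon> i\<bar> = 1" unfolding abs_prod
    proof (intro prod.neutral ballI)
      fix i assume "i \<in> S"
      then have "i \<in> I" using S by auto
      then show "\<bar>\<epsilon> i\<bar> = 1" using \<epsilon>[of i] by auto
    qed
    then have "\<bar>X S N\<bar> \<le> C" for N using C[of N] by (simp add: X_def abs_mult)
    then show ?thesis by blast
  qed
  then obtain C where C: "\<And>S N. S \<in> Pow I - {{}} \<Longrightarrow> \<bar>X S N\<bar> \<le> C S" by metis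
  have lower: "(\<Sum>n\<in>{1..N}. mangoldt n / real n) - (\<Sum>S\<in>Pow I - {{}}. C S)
      \<le> (\<Sum>n\<in>{1..N}. mangoldt n / real n * P n)" for N
  proof -
    have P: "P n = (\<Sum>S\<in>Pow I. (\<Prod>i\<in>S. \<epsilon> i) * (\<Prod>i\<in>S. \<chi> i n))" for n
    proof -
      have "P n = (\<Prod>i\<in>I. \<epsilon> i * \<chi> i n + 1)" by (simp add: P_def add.commute)
      also have "\<dots> = (\<Sum>S\<in>Pow I. (\<Prod>i\<in>S. \<epsilon> i * \<chi> i n) * (\<Prod>i\<in>I - S. 1))"
        by (rule prod_add[OF fin(1)])
      finally show ?thesis by (simp add: prod.distrib)
    qed
    have "(\<Sum>n\<in>{1..N}. mangoldt n / real n * P n)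
        = (\<Sum>n\<in>{1..N}. \<Sum>S\<in>Pow I. (\<Prod>i\<in>S. \<epsilon> i) * ((\<Prod>i\<in>S. \<chi> i n) * (mangoldt n / real n)))"
      unfolding P sum_distrib_left by (intro sum.cong refl) (simp add: mult_ac)
    also have "\<dots> = (\<Sum>S\<in>Pow I. X S N)"
      unfolding X_def by (subst sum.swap) (simp only: sum_distrib_left)
    also have "\<dots> = X {} N + (\<Sum>S\<in>Pow I - {{}}. X S N)"
      using fin(1) by (intro sum.remove) auto
    also have "X {} N = (\<Sum>n\<in>{1..N}. mangoldt n / real n)" by (simp add: X_def)
    finally have eq: "(\<Sum>n\<in>{1..N}. mangoldt n / real n * P n)
        = (\<Sum>n\<in>{1..N}. mangoldt n / real n) + (\<Sum>S\<in>Pow I - {{}}. X S N)" .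
    have "- (\<Sum>S\<in>Pow I - {{}}. C S) \<le> (\<Sum>S\<in>Pow I - {{}}. X S N)"
      unfolding sum_negf[symmetric]
    proof (rule sum_mono)
      fix S assume "S \<in> Pow I - {{}}"
      then show "- C S \<le> X S N" using C[of S N] by linarith
    qed
    then show ?thesis using eq by linarith
  qed
  define B where "B = 2 * (U + (\<Sum>S\<in>Pow I - {{}}. C S))"
  obtain K where K: "exp (B + 1) < real K" using reals_Archimedean2 by blast
  then have "B + 1 < ln (real K)" by (smt (verit) exp_gt_zero ln_exp ln_less_cancel_iff)
  also have "\<dots> \<le> B"
    using sum_mangoldt_over_lower_bound[of K] lower[of "2 * K"] upper[of "2 * K"] by (simp add: B_def)
  finally show False by simp
qed

section \<open>Quadratic characters\<close>

lemma Legendre_range: "Legendre a p \<in> {-1, 0, 1}"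
  by (simp add: Legendre_def)

lemma sign_eq_of_cong:
  fixes x y :: int
  assumes "x \<in> {-1, 0, 1}" "y \<in> {-1, 0, 1}" "[x = y] (mod int p)" "p > 2"
  shows "x = y"
proof -
  have "int p dvd x - y" using assms(3) by (simp add: cong_iff_dvd_diff)
  moreover have "\<bar>x - y\<bar> < int p" using assms by auto
  ultimately have "x - y = 0" by (metis dvd_imp_le_int not_le abs_of_nat)
  then show ?thesis by simp
qed

lemma Legendre_mult:
  assumes "prime p" "p > 2"
  shows "Legendre (a * b) (int p) = Legendre a (int p) * Legendre b (int p)"
proof (rule sign_eq_of_cong[OF _ _ _ assms(2)])
  let ?e = "(p - 1) div 2"
  have "[Legendre (a * b) p = (a * b) ^ ?e] (mod p)" using assms by (rule euler_criterion)
  moreover have "[Legendre a p * Legendre b p = a ^ ?e * b ^ ?e] (mod p)"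
    using assms by (intro cong_mult euler_criterion)
  ultimately show "[Legendre (a * b) p = Legendre a p * Legendre b p] (mod p)"
    by (metis cong_sym cong_trans power_mult_distrib)
  show "Legendre (a * b) p \<in> {-1, 0, 1}" by (rule Legendre_range)
  show "Legendre a p * Legendre b p \<in> {-1, 0, 1}"
    using Legendre_range[of a p] Legendre_range[of b p] by auto
qed

lemma Legendre_cong:
  assumes "[a = b] (mod p)"
  shows "Legendre a p = Legendre b p"
proof -
  have "[a = 0] (mod p) \<longleftrightarrow> [b = 0] (mod p)" using assms by (metis cong_sym cong_trans)
  moreover have "QuadRes p a \<longleftrightarrow> QuadRes p b"
    using assms unfolding QuadRes_def by (metis cong_sym cong_trans)
  ultimately show ?thesis by (simp add: Legendre_def)
qed

lemma Legendre_1: "prime p \<Longrightarrow> Legendre 1 (int p) = 1"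
  by (auto simp: Legendre_def QuadRes_def cong_0_iff intro: exI[of _ 1])

lemma Legendre_eq_0_iff: "Legendre a p = 0 \<longleftrightarrow> p dvd a"
  by (simp add: Legendre_def cong_0_iff)

text \<open>Otherwise squaring would map the nonzero residues onto themselves, hence injectively,
  although 1 and \<open>p - 1\<close> have the same square.\<close>

lemma exists_quadratic_nonresidue:
  assumes "prime p" "p > 2"
  shows "\<exists>a::nat. Legendre (int a) (int p) = -1"
proof (rule ccontr)
  assume none: "\<not> ?thesis"
  have gt: "1 < p" using assms by simp
  define f where "f x = x\<^sup>2 mod p" for x :: nat
  have "{1..<p} \<subseteq> f ` {1..<p}"
  proof
    fix a assume a: "a \<in> {1..<p}"
    then have "\<not> int p dvd int a" by (auto dest: dvd_imp_le)
    then have "Legendre (int a) (int p) \<noteq> 0" by (simp add: Legendre_eq_0_iff)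
    then have "QuadRes (int p) (int a)" using none by (auto simp: Legendre_def split: if_splits)
    then obtain y where y: "[y\<^sup>2 = int a] (mod int p)" unfolding QuadRes_def by blast
    define x where "x = nat (y mod int p)"
    have x: "int x = y mod int p" using gt by (simp add: x_def)
    have "int (f x) = (y mod int p)\<^sup>2 mod int p" by (simp add: f_def x zmod_int)
    also have "\<dots> = int a mod int p" using y by (simp add: cong_def power_mod)
    also have "\<dots> = int a" using a by simp
    finally have fx: "f x = a" by simp
    moreover have "x < p" using gt by (simp add: x_def nat_less_iff)
    moreover have "x \<noteq> 0" using fx a by (intro notI) (simp add: f_def)
    ultimately show "a \<in> f ` {1..<p}" by (intro image_eqI[of _ _ x]) auto
  qed
  then have "card {1..<p} \<le> card (f ` {1..<p})" by (intro card_mono) auto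
  then have "card (f ` {1..<p}) = card {1..<p}"
    using card_image_le[of "{1..<p}" f] by (intro antisym) auto
  then have "inj_on f {1..<p}" by (intro eq_card_imp_inj_on) auto
  moreover have "f 1 = f (p - 1)"
  proof -
    obtain r where "p = Suc (Suc r)" using assms(2) by (metis Suc_lessE numeral_2_eq_2)
    then have "(p - 1)\<^sup>2 = 1 + p * (p - 2)" by (simp add: power2_eq_square algebra_simps)
    then show ?thesis unfolding f_def by (simp only: mod_mult_self2 power_one)
  qed
  ultimately have "1 = p - 1" using assms(2) by (auto dest: inj_onD)
  then show False using assms(2) by simp
qed

definition character_4 :: "nat \<Rightarrow> int"
  where "character_4 n = (if even n then 0 else if n mod 4 = 1 then 1 else -1)"

lemma character_4_mult: "character_4 (m * n) = character_4 m * character_4 n"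
proof (cases "even m \<or> even n")
  case True
  then show ?thesis by (auto simp: character_4_def)
next
  case False
  then have "odd m" "odd n" "odd (m * n)" by simp_all
  then have "m mod 4 = 1 \<or> m mod 4 = 3" "n mod 4 = 1 \<or> n mod 4 = 3" by presburger+
  moreover have "m * n mod 4 = (m mod 4) * (n mod 4) mod 4" by (simp only: mod_mult_eq)
  ultimately have "m * n mod 4 = 1 \<longleftrightarrow> (m mod 4 = 1 \<longleftrightarrow> n mod 4 = 1)" by (elim disjE) simp_all
  then show ?thesis
    using \<open>odd m\<close> \<open>odd n\<close> \<open>odd (m * n)\<close> by (simp only: character_4_def if_False split: if_split) simp
qed

lemma character_4_mod: "character_4 (n mod 4) = character_4 n"
proof -
  have "even (n mod 4) \<longleftrightarrow> even n" by presburger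
  then show ?thesis by (simp add: character_4_def)
qed

lemma Legendre_minus_1:
  assumes "prime p" "p > 2"
  shows "Legendre (-1) (int p) = character_4 p"
proof (rule sign_eq_of_cong[OF Legendre_range _ _ assms(2)])
  have "odd p" using assms prime_odd_nat by blast
  then have "p mod 4 = 1 \<or> p mod 4 = 3" by presburger
  then have "(-1) ^ ((p - 1) div 2) = character_4 p"
  proof
    assume 1: "p mod 4 = 1"
    define r where "r = p div 4"
    have "p = 4 * r + 1" using 1 div_mult_mod_eq[of p 4] by (simp add: r_def)
    then have "even ((p - 1) div 2)" by simp
    then show ?thesis using 1 \<open>odd p\<close> by (simp add: character_4_def)
  next
    assume 3: "p mod 4 = 3"
    define r where "r = p div 4"
    have "p = 4 * r + 3" using 3 div_mult_mod_eq[of p 4] by (simp add: r_def)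
    then have "(p - 1) div 2 = 2 * r + 1" by simp
    then have "odd ((p - 1) div 2)" by simp
    then show ?thesis using 3 \<open>odd p\<close> by (simp add: character_4_def)
  qed
  then show "[Legendre (-1) (int p) = character_4 p] (mod int p)"
    using euler_criterion[OF assms, of "-1"] by simp
  show "character_4 p \<in> {-1, 0, 1}" by (simp add: character_4_def)
qed

text \<open>The characters are indexed by their conductor: an odd prime, or \<open>4\<close>.\<close>
definition quadratic_character :: "nat \<Rightarrow> nat \<Rightarrow> int"
  where "quadratic_character i n = (if i = 4 then character_4 n else Legendre (int n) (int i))"

definition conductors :: "nat set"
  where "conductors = insert 4 {p. prime p \<and> p > 2}"

lemma four_not_prime: "\<not> prime (4 :: nat)"
  using prime_product[of 2 2] by auto

lemma quadratic_character_range: "quadratic_character i n \<in> {-1, 0, 1}"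
  using Legendre_range by (simp add: quadratic_character_def character_4_def)

lemma quadratic_character_mult:
  "i \<in> conductors \<Longrightarrow> quadratic_character i (m * n) = quadratic_character i m * quadratic_character i n"
  by (auto simp: quadratic_character_def conductors_def character_4_mult Legendre_mult)

lemma quadratic_character_1: "i \<in> conductors \<Longrightarrow> quadratic_character i 1 = 1"
  using Legendre_1[of i] by (auto simp: quadratic_character_def conductors_def character_4_def)

lemma quadratic_character_cong:
  assumes "[m = n] (mod i)"
  shows "quadratic_character i m = quadratic_character i n"
proof (cases "i = 4")
  case True
  then show ?thesis using assms character_4_mod[of m] character_4_mod[of n]
    by (simp add: quadratic_character_def cong_def)
next
  case False
  then show ?thesis using assms
    by (simp add: quadratic_character_def Legendre_cong cong_int_iff)
qed

lemma quadratic_character_nonzero_coprime: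
  assumes "i \<in> conductors" "quadratic_character i n \<noteq> 0"
  shows "coprime n i"
proof (cases "i = 4")
  case True
  then have "odd n" using assms(2) by (auto simp: quadratic_character_def character_4_def)
  then have "coprime n 2" by simp
  then have "coprime n (2 * 2)" by (simp only: coprime_mult_right_iff simp_thms)
  then show ?thesis using True by simp
next
  case False
  then have "prime i" "\<not> i dvd n" using assms
    by (auto simp: conductors_def quadratic_character_def Legendre_eq_0_iff)
  then show ?thesis by (metis coprime_commute prime_imp_coprime)
qed

lemma quadratic_character_attains_minus_1:
  assumes "i \<in> conductors"
  shows "\<exists>a. quadratic_character i a = -1"
proof (cases "i = 4")
  case True
  then show ?thesis by (intro exI[of _ 3]) (simp add: quadratic_character_def character_4_def)
next
  case False
  then show ?thesis using assms exists_quadratic_nonresidue[of i]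
    by (auto simp: conductors_def quadratic_character_def)
qed

lemma conductors_coprime:
  assumes "i \<in> conductors" "j \<in> conductors" "i \<noteq> j"
  shows "coprime i j"
proof -
  have "coprime 4 p" if "prime p" "p > 2" for p :: nat
  proof -
    have "odd p" using that prime_odd_nat by blast
    then have "coprime 2 p" by simp
    then have "coprime (2 * 2) p" by (simp only: coprime_mult_left_iff simp_thms)
    then show ?thesis by simp
  qed
  then show ?thesis using assms
    by (auto simp: conductors_def primes_coprime coprime_commute)
qed

text \<open>For the vanishing period sum, the Chinese remainder theorem gives an \<open>a\<close> at
  which one factor is -1 and the others are 1. Multiplication by \<open>a\<close> permutes the
  residues and changes the sign of the sum.\<close>

lemma real_character_prod_quadratic_character:
  assumes "finite S" "S \<subseteq> conductors" "S \<noteq> {}"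
  shows "real_character (\<lambda>n. \<Prod>i\<in>S. of_int (quadratic_character i n)) (\<Prod>S)"
proof
  let ?\<chi> = "\<lambda>n. \<Prod>i\<in>S. quadratic_character i n"
  have real: "(\<Prod>i\<in>S. of_int (quadratic_character i n)) = (of_int (?\<chi> n) :: real)" for n by simp
  have S: "i \<in> conductors" if "i \<in> S" for i using assms(2) that by blast
  have pos: "i > 0" if "i \<in> S" for i using S[OF that] by (auto simp: conductors_def)
  show Q: "\<Prod>S > 0" using pos by (intro prod_pos) auto
  have mult: "?\<chi> (m * n) = ?\<chi> m * ?\<chi> n" for m n
    by (simp add: prod.distrib[symmetric] quadratic_character_mult S)
  then show "(\<Prod>i\<in>S. of_int (quadratic_character i (m * n))) =
      (\<Prod>i\<in>S. of_int (quadratic_character i m)) * (\<Prod>i\<in>S. of_int (quadratic_character i n) :: real)" for m n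
    unfolding real by (metis of_int_mult)
  have cong: "?\<chi> m = ?\<chi> n" if "[m = n] (mod \<Prod>S)" for m n
  proof (intro prod.cong refl quadratic_character_cong)
    fix i assume "i \<in> S"
    then have "i dvd \<Prod>S" using assms(1) by (rule dvd_prodI[of S _ "\<lambda>x. x", simplified, rotated])
    then show "[m = n] (mod i)" using that by (rule cong_dvd_modulus_nat[rotated])
  qed
  then show "(\<Prod>i\<in>S. of_int (quadratic_character i (n + \<Prod>S))) =
      (\<Prod>i\<in>S. of_int (quadratic_character i n) :: real)" for n
    unfolding real by (metis cong_def mod_add_self2)
  show "(\<Prod>i\<in>S. of_int (quadratic_character i n)) \<in> {-1, 0, 1 :: real}" for n
  proof -
    have "?\<chi> n \<in> {-1, 0, 1}" using assms(1)
    proof (induction S)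
      case (insert i S)
      then show ?case using quadratic_character_range[of i n] by auto
    qed auto
    then show ?thesis unfolding real
      by (elim insertE emptyE) (simp_all only: of_int_minus of_int_0 of_int_1 insert_iff simp_thms)
  qed
  show "(\<Prod>i\<in>S. of_int (quadratic_character i 1)) = (1 :: real)"
    using quadratic_character_1 S by (intro prod.neutral) auto
  obtain j where j: "j \<in> S" using assms(3) by blast
  obtain c where c: "quadratic_character j c = -1"
    using quadratic_character_attains_minus_1[OF S[OF j]] by blast
  obtain a where a: "\<And>i. i \<in> S \<Longrightarrow> [a = (if i = j then c else 1)] (mod i)"
    using chinese_remainder_nat[of S "\<lambda>i. i" "\<lambda>i. if i = j then c else 1"] assms(1)
      conductors_coprime S by blast
  have val: "quadratic_character i a = (if i = j then -1 else 1)" if "i \<in> S" for i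
    using quadratic_character_cong[OF a[OF that]] c quadratic_character_1[OF S[OF that]] by auto
  have chi_a: "?\<chi> a = -1"
    using assms(1) j by (simp add: val prod.remove[of S j])
  have cop: "coprime a (\<Prod>S)"
    using val S by (intro prod_coprime_right quadratic_character_nonzero_coprime) (auto split: if_splits)
  have inj: "inj_on (\<lambda>n. a * n mod \<Prod>S) {..<\<Prod>S}"
  proof (rule inj_onI)
    fix x y assume xy: "x \<in> {..<\<Prod>S}" "y \<in> {..<\<Prod>S}" "a * x mod \<Prod>S = a * y mod \<Prod>S"
    then have "[x = y] (mod \<Prod>S)" using cop by (metis cong_def cong_mult_lcancel_nat)
    then show "x = y" using xy by (auto simp: cong_def)
  qed
  have "(\<lambda>n. a * n mod \<Prod>S) ` {..<\<Prod>S} = {..<\<Prod>S}"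
    using inj Q by (intro endo_inj_surj) auto
  then have "sum ?\<chi> {..<\<Prod>S} = sum ?\<chi> ((\<lambda>n. a * n mod \<Prod>S) ` {..<\<Prod>S})" by simp
  also have "\<dots> = (\<Sum>n<\<Prod>S. ?\<chi> (a * n mod \<Prod>S))" using inj by (simp add: sum.reindex)
  also have "\<dots> = (\<Sum>n<\<Prod>S. ?\<chi> (a * n))" by (intro sum.cong refl cong) (simp add: cong_def)
  also have "\<dots> = - sum ?\<chi> {..<\<Prod>S}" by (simp only: mult chi_a) (simp add: sum_negf)
  finally have "sum ?\<chi> {..<\<Prod>S} = 0" by simp
  then show "(\<Sum>n<\<Prod>S. \<Prod>i\<in>S. of_int (quadratic_character i n)) = (0 :: real)"
    unfolding real of_int_sum[symmetric] by simp
qed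

section \<open>Sums of three squares\<close>

lemma exists_auxiliary_prime:
  assumes "finite A" and A: "\<And>p. p \<in> A \<Longrightarrow> prime p \<and> p > 2"
  shows "\<exists>q. (q = 1 \<or> prime q) \<and> q mod 4 = 1 \<and>
           (\<forall>p\<in>A. Legendre (int q) (int p) = Legendre (-1) (int p))"
proof (cases "\<forall>p\<in>A. Legendre (-1) (int p) = 1")
  case True
  then show ?thesis using A by (intro exI[of _ 1]) (auto simp: Legendre_1)
next
  case False
  \<comment> \<open>A target sign -1 forces the exponent \<open>k\<close> below to be odd, so that
    \<open>q\<close> has the same character values as \<open>q ^ k\<close>. With all target signs
    equal to 1 this would fail, and \<open>q = 1\<close> was taken instead.\<close>
  then obtain p0 where p0: "p0 \<in> A" "Legendre (-1) (int p0) \<noteq> 1" by blast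
  have sub: "insert 4 A \<subseteq> conductors" using A by (auto simp: conductors_def)
  define s where "s i = (if i = 4 then 1 else Legendre (-1) (int i))" for i
  have s: "s i \<in> {-1, 1}" if "i \<in> insert 4 A" for i
  proof (cases "i = 4")
    case False
    then have "prime i" "i > 2" using that A by auto
    then have "Legendre (-1) (int i) \<noteq> 0" by (simp add: Legendre_eq_0_iff)
    then show ?thesis using Legendre_range[of "-1" "int i"] False by (auto simp: s_def)
  qed (simp add: s_def)
  have "\<exists>q k. prime q \<and> k > 0 \<and>
      (\<forall>i\<in>insert 4 A. (of_int (quadratic_character i (q ^ k)) :: real) = of_int (s i))"
  proof (rule exists_prime_power_with_signs)
    show "finite (insert 4 A)" "finite (insert 2 A)" using assms(1) by auto
    show "prime p" if "p \<in> insert 2 A" for p using that A by auto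
    show "\<exists>Q. real_character (\<lambda>n. \<Prod>i\<in>S. of_int (quadratic_character i n)) Q"
      if "S \<subseteq> insert 4 A" "S \<noteq> {}" for S
      using that sub assms(1)
      by (intro exI[of _ "\<Prod>S"] real_character_prod_quadratic_character)
         (auto intro: finite_subset[of _ "insert 4 A"])
    show "(of_int (quadratic_character i p) :: real) \<noteq> 0"
      if i: "i \<in> insert 4 A" and p: "prime p" "p \<notin> insert 2 A" for i p
    proof (cases "i = 4")
      case True
      have "odd p" using p prime_prime_factor two_is_prime_nat primes_dvd_imp_eq by blast
      then show ?thesis using True by (simp add: quadratic_character_def character_4_def)
    next
      case False
      then have "prime i" "i \<noteq> p" using i p A by auto
      then have "\<not> i dvd p" using p(1) primes_dvd_imp_eq by blast
      then show ?thesis using False by (simp add: quadratic_character_def Legendre_eq_0_iff)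
    qed
    show "of_int (s i) \<in> {-1, 1 :: real}" if "i \<in> insert 4 A" for i using s[OF that] by auto
  qed
  then obtain q k where q: "prime q" "k > 0"
    and val: "\<And>i. i \<in> insert 4 A \<Longrightarrow> quadratic_character i (q ^ k) = s i" by auto
  have pow: "quadratic_character i (q ^ k) = quadratic_character i q ^ k" if "i \<in> insert 4 A" for i
  proof (induction k)
    case 0
    then show ?case using quadratic_character_1 sub that by auto
  next
    case (Suc k)
    then show ?case using quadratic_character_mult[of i q "q ^ k"] sub that by auto
  qed
  have "p0 \<noteq> 4" using A[OF p0(1)] four_not_prime by auto
  then have "s p0 = -1" using s[of p0] p0 by (auto simp: s_def)
  then have neg: "quadratic_character p0 q ^ k = -1" using pow[of p0] val[of p0] p0(1) by simp
  have "odd k"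
  proof
    assume "even k"
    then have "0 \<le> quadratic_character p0 q ^ k" by (rule zero_le_even_power)
    then show False using neg by simp
  qed
  have val_q: "quadratic_character i q = s i" if "i \<in> insert 4 A" for i
  proof -
    have "quadratic_character i q ^ k = quadratic_character i q"
      using quadratic_character_range[of i q] \<open>odd k\<close> q(2) by auto
    then show ?thesis using pow[OF that] val[OF that] by simp
  qed
  have "character_4 q = 1" using val_q[of 4] by (simp add: quadratic_character_def s_def)
  then have "q mod 4 = 1" by (simp add: character_4_def split: if_splits)
  moreover have "Legendre (int q) (int p) = Legendre (-1) (int p)" if "p \<in> A" for p
  proof -
    have "p \<noteq> 4" using A[OF that] four_not_prime by auto
    then show ?thesis using val_q[of p] that by (simp add: quadratic_character_def s_def)
  qed
  ultimately show ?thesis using q(1) by blast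
qed

lemma Legendre_prod:
  assumes "prime q" "q > 2"
  shows "Legendre (int (\<Prod>A)) (int q) = (\<Prod>p\<in>A. Legendre (int p) (int q))"
  by (induction A rule: infinite_finite_induct) (use assms in \<open>simp_all add: Legendre_1 Legendre_mult\<close>)

lemma character_4_prod: "character_4 (\<Prod>A) = (\<Prod>p\<in>A. character_4 p)"
  by (induction A rule: infinite_finite_induct) (simp_all add: character_4_mult, simp_all add: character_4_def)

lemma Legendre_reciprocity_1_mod_4:
  assumes "prime p" "p > 2" "prime q" "q mod 4 = 1" "p \<noteq> q"
  shows "Legendre (int p) (int q) = Legendre (int q) (int p)"
proof -
  define r where "r = q div 4"
  have r: "q = 4 * r + 1" using assms(4) div_mult_mod_eq[of q 4] by (simp add: r_def)
  then have "r \<noteq> 0" using assms(3) by (intro notI) simp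
  then have "q > 2" using r by simp
  have "even ((q - 1) div 2)" using r by simp
  then have "(-1 :: int) ^ ((p - 1) div 2 * ((q - 1) div 2)) = 1" by simp
  then have "Legendre (int p) (int q) * Legendre (int q) (int p) = 1"
    using Quadratic_Reciprocity[OF assms(1,2,3) \<open>q > 2\<close> assms(5)] by argo
  then show ?thesis using Legendre_range[of "int p" "int q"] Legendre_range[of "int q" "int p"] by auto
qed

text \<open>
  Reciprocity makes \<open>-n\<close> a square modulo the auxiliary prime \<open>q\<close>, and the choice of \<open>q\<close> makes
  \<open>-q\<close> a square modulo \<open>n\<close>; these are the two congruences behind the unimodular ternary form.
\<close>
lemma sum_three_squares_squarefree:
  fixes n :: nat
  assumes "squarefree n" "n mod 4 = 1"
  shows "sum_three_squares (int n)"
proof -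
  define A where "A = prime_factors n"
  have "n \<noteq> 0" using assms(2) by (intro notI) simp
  have fin: "finite A" by (simp add: A_def)
  have "odd n" using assms(2) by presburger
  have A: "prime p \<and> p > 2" if "p \<in> A" for p
  proof -
    have p: "prime p" "p dvd n" using that by (auto simp: A_def prime_factors_dvd)
    then have "odd p" using \<open>odd n\<close> by auto
    then show ?thesis using p prime_ge_2_nat[of p] by (cases "p = 2") auto
  qed
  have n: "n = \<Prod>A"
  proof -
    have "n = (\<Prod>p\<in>A. p ^ multiplicity p n)"
      unfolding A_def using \<open>n \<noteq> 0\<close> by (intro prime_factorization_nat) simp
    also have "\<dots> = \<Prod>A"
    proof (intro prod.cong refl)
      fix p assume "p \<in> A"
      then have "prime p" "multiplicity p n > 0"
        using \<open>n \<noteq> 0\<close> by (auto simp: A_def prime_factors_multiplicity)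
      moreover have "multiplicity p n \<le> 1"
        using assms(1) squarefree_factorial_semiring''[of n] \<open>n \<noteq> 0\<close> \<open>prime p\<close> by simp
      ultimately have "multiplicity p n = 1" by linarith
      then show "p ^ multiplicity p n = p" by simp
    qed
    finally show ?thesis .
  qed
  have coprime_A: "coprime p p'" if "p \<in> A" "p' \<in> A" "p \<noteq> p'" for p p'
    using A that by (intro primes_coprime) auto
  have "\<exists>q. (q = 1 \<or> prime q) \<and> q mod 4 = 1 \<and>
      (\<forall>p\<in>A. Legendre (int q) (int p) = Legendre (-1) (int p))"
    using fin A by (rule exists_auxiliary_prime)
  then obtain q where q: "q = 1 \<or> prime q" "q mod 4 = 1"
    and "\<forall>p\<in>A. Legendre (int q) (int p) = Legendre (-1) (int p)"
    by (elim exE conjE) (rule that)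
  then have Legendre_q: "Legendre (int q) (int p) = Legendre (-1) (int p)" if "p \<in> A" for p
    using that by blast
  have q_pos: "q > 0" using q(2) by (intro Nat.gr0I) simp
  have q_nonzero: "Legendre (int q) (int p) \<noteq> 0" if "p \<in> A" for p
  proof -
    have "\<not> int p dvd -1" using A[OF that] by simp
    then show ?thesis using Legendre_q[OF that] by (simp add: Legendre_eq_0_iff)
  qed
  have "\<exists>y. [y\<^sup>2 + q = 0] (mod p)" if "p \<in> A" for p
  proof -
    have p: "prime p" "p > 2" using A[OF that] by auto
    have "Legendre (- int q) (int p) = Legendre (-1) (int p) * Legendre (int q) (int p)"
      using Legendre_mult[OF p, of "-1" "int q"] by simp
    also have "\<dots> = 1"
      using Legendre_q[OF that] q_nonzero[OF that] Legendre_range[of "-1" "int p"] by auto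
    finally have "QuadRes (int p) (- int q)" by (simp add: Legendre_def split: if_splits)
    then obtain y where y: "[y\<^sup>2 = - int q] (mod int p)" unfolding QuadRes_def by blast
    define x where "x = nat (y mod int p)"
    have x: "int x = y mod int p" using p by (simp add: x_def)
    have "[(int x)\<^sup>2 = y\<^sup>2] (mod int p)" unfolding x by (intro cong_pow) (simp add: cong_def)
    then have "[(int x)\<^sup>2 + int q = - int q + int q] (mod int p)"
      using y by (intro cong_add cong_refl) (metis cong_trans)
    then have "[int (x\<^sup>2 + q) = int 0] (mod int p)" by simp
    then show ?thesis by (metis cong_int_iff)
  qed
  then obtain Y where Y: "\<And>p. p \<in> A \<Longrightarrow> [(Y p)\<^sup>2 + q = 0] (mod p)" by metis
  obtain y where y: "\<And>p. p \<in> A \<Longrightarrow> [y = Y p] (mod p)"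
    using chinese_remainder_nat[of A "\<lambda>p. p" Y] fin coprime_A by blast
  have "[y\<^sup>2 + q = 0] (mod \<Prod>A)"
  proof (intro cong_cong_prod_coprime_nat ballI impI)
    fix p assume p: "p \<in> A"
    have "[y\<^sup>2 + q = (Y p)\<^sup>2 + q] (mod p)" using y[OF p] by (intro cong_add cong_pow cong_refl)
    then show "[y\<^sup>2 + q = 0] (mod p)" using Y[OF p] by (rule cong_trans)
  qed (use coprime_A in auto)
  then have "n dvd y\<^sup>2 + q" unfolding n[symmetric] by (simp add: cong_0_iff)
  then have ny: "int n dvd (int y)\<^sup>2 + int q" by (metis int_dvd_int_iff of_nat_add of_nat_power)
  have "coprime q n" unfolding n
  proof (intro prod_coprime_right)
    fix p assume p: "p \<in> A"
    then have "\<not> p dvd q" using q_nonzero by (simp add: Legendre_eq_0_iff)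
    then show "coprime q p" using A[OF p] by (metis coprime_commute prime_imp_coprime)
  qed
  then have "coprime (int q) (int n)" by simp
  then obtain r where r: "[int q * r = 1] (mod int n)" using cong_solve_coprime_int by blast
  \<comment> \<open>With \<open>r\<close> inverse to \<open>q\<close> and \<open>y\<^sup>2\<close>
    congruent to \<open>- q\<close>, the product \<open>t\<^sup>2 * q\<close> is congruent to -1
    modulo \<open>n\<close>.\<close>
  define t where "t = int y * r"
  have "[t\<^sup>2 * int q + 1 = ((int y)\<^sup>2 + int q) * (r\<^sup>2 * int q) - (int q * r)\<^sup>2 + 1] (mod int n)"
    by (simp add: t_def algebra_simps power2_eq_square)
  also have "[((int y)\<^sup>2 + int q) * (r\<^sup>2 * int q) - (int q * r)\<^sup>2 + 1 = 0 * (r\<^sup>2 * int q) - 1\<^sup>2 + 1] (mod int n)"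
    using ny r by (intro cong_add cong_diff cong_mult cong_pow cong_refl) (simp_all add: cong_0_iff)
  finally have "int n dvd t\<^sup>2 * int q + 1" by (simp add: cong_0_iff)
  then obtain k where k: "t\<^sup>2 * int q + 1 = int n * k" by blast
  have "0 < int n * k" unfolding k[symmetric] by (smt (verit) mult_nonneg_nonneg of_nat_0_le_iff zero_le_power2)
  then have k_pos: "k > 0" by (simp add: zero_less_mult_iff)
  \<comment> \<open>Modulo \<open>q\<close> the product \<open>n * k\<close> is 1, so any
    \<open>b\<close> with \<open>b\<^sup>2\<close> congruent to \<open>- n\<close> works.\<close>
  have "\<exists>b. int q dvd k * b\<^sup>2 + 1"
    using q(1)
  proof
    assume "prime q"
    define r where "r = q div 4"
    have "q = 4 * r + 1" using q(2) div_mult_mod_eq[of q 4] by (simp add: r_def)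
    moreover from this have "r \<noteq> 0" using \<open>prime q\<close> by (intro notI) simp
    ultimately have "q > 2" by simp
    note prime_q = \<open>prime q\<close> \<open>q > 2\<close>
    have "Legendre (int n) (int q) = (\<Prod>p\<in>A. Legendre (int p) (int q))"
      unfolding n by (rule Legendre_prod[OF prime_q])
    \<comment> \<open>Reciprocity with \<open>q\<close> congruent to 1 modulo 4 exchanges
      \<open>p\<close> and \<open>q\<close>, and by choice of \<open>q\<close> the symbol of
      \<open>q\<close> modulo \<open>p\<close> is that of -1.\<close>
    also have "\<dots> = (\<Prod>p\<in>A. character_4 p)"
    proof (intro prod.cong refl)
      fix p assume p: "p \<in> A"
      have "p \<noteq> q" using q_nonzero[OF p] by (auto simp: Legendre_eq_0_iff)
      then show "Legendre (int p) (int q) = character_4 p"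
        using A[OF p] Legendre_q[OF p] Legendre_minus_1[of p]
          Legendre_reciprocity_1_mod_4[of p q] prime_q q(2) by simp
    qed
    also have "\<dots> = character_4 n" unfolding n by (rule character_4_prod[symmetric])
    also have "\<dots> = 1" using assms(2) \<open>odd n\<close> by (simp add: character_4_def)
    finally have "Legendre (int n) (int q) = 1" .
    moreover have "odd q" using q(2) by presburger
    then have "Legendre (-1) (int q) = 1" using Legendre_minus_1[OF prime_q] q(2) by (simp add: character_4_def)
    ultimately have "Legendre (- int n) (int q) = 1" using Legendre_mult[OF prime_q, of "-1" "int n"] by simp
    then have "QuadRes (int q) (- int n)" by (simp add: Legendre_def split: if_splits)
    then obtain b where "[b\<^sup>2 = - int n] (mod int q)" unfolding QuadRes_def by blast
    then have "[k * b\<^sup>2 + 1 = k * (- int n) + 1] (mod int q)" by (intro cong_add cong_mult cong_refl)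
    also have "k * (- int n) + 1 = int q * (- t\<^sup>2)" using k by (simp add: algebra_simps)
    finally have "int q dvd k * b\<^sup>2 + 1" by (simp add: cong_dvd_iff)
    then show ?thesis by blast
  qed simp
  then obtain b m where "k * b\<^sup>2 + 1 = int q * m" by (auto elim: dvdE)
  then show ?thesis
    using sum_three_squares_criterion[of "int q" k "int n" t m b] k k_pos q_pos by simp
qed

text \<open>The square part is odd, so the squarefree part is still 1 modulo 4, and the square is
  multiplied back in.\<close>

theorem sum_three_squares_1_mod_4:
  fixes n :: int
  assumes "n > 0" "n mod 4 = 1"
  shows "sum_three_squares n"
proof -
  define N where "N = nat n"
  have N: "n = int N" using assms(1) by (simp add: N_def)
  then have N4: "N mod 4 = 1" using assms(2) by (metis of_nat_1 of_nat_eq_iff of_nat_mod of_nat_numeral)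
  define f where "f = square_part N"
  define g where "g = squarefree_part N"
  have fg: "N = g * f\<^sup>2" unfolding f_def g_def by (rule squarefree_decompose)
  have "odd N" using N4 by presburger
  then have "odd f" using fg by auto
  then obtain e where e: "f = 2 * e + 1" by (rule oddE)
  have "N = g + 4 * (g * (e\<^sup>2 + e))" unfolding fg e by (simp add: algebra_simps power2_eq_square)
  then have "N mod 4 = g mod 4" by (simp only: mod_mult_self2)
  then have "g mod 4 = 1" using N4 by argo
  then have "sum_three_squares (int g)"
    unfolding g_def by (rule sum_three_squares_squarefree[OF squarefree_squarefree_part])
  then have "\<exists>x y z. int g = x\<^sup>2 + y\<^sup>2 + z\<^sup>2" unfolding sum_three_squares_def .
  then obtain x y z where "int g = x\<^sup>2 + y\<^sup>2 + z\<^sup>2" by blast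
  moreover have "n = int g * (int f)\<^sup>2" unfolding N fg by simp
  ultimately have "n = (int f * x)\<^sup>2 + (int f * y)\<^sup>2 + (int f * z)\<^sup>2"
    by (simp only:) (simp add: power_mult_distrib algebra_simps)
  then show ?thesis unfolding sum_three_squares_def by blast
qed

section \<open>Exceptions for m congruent to 2 modulo 4\<close>

lemma complete_square_polygonal:
  "4 * k * polygonal (2 * k + 2) x + (k - 1)\<^sup>2 = (2 * k * x - (k - 1))\<^sup>2"
proof -
  have "2 * (x * (x - 1) div 2) = x * (x - 1)" by simp
  then have "4 * k * polygonal (2 * k + 2) x = 4 * k\<^sup>2 * (x * (x - 1)) + 4 * k * x"
    unfolding polygonal_def by (simp add: algebra_simps power2_eq_square)
  then show ?thesis by (simp add: algebra_simps power2_eq_square)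
qed

text \<open>The form \<open>y\<^sub>1\<^sup>2 + y\<^sub>2\<^sup>2 + 2 * y\<^sub>3\<^sup>2 + 2 * y\<^sub>4\<^sup>2\<close> is anisotropic over the 2-adic numbers.\<close>
lemma even_of_16_dvd:
  fixes a b c d :: int
  assumes "16 dvd a\<^sup>2 + b\<^sup>2 + 2 * c\<^sup>2 + 2 * d\<^sup>2"
  shows "even a \<and> even b \<and> even c \<and> even d"
proof -
  \<comment> \<open>The residue of a square modulo 16 depends only on the root modulo 8, which
    leaves a finite check.\<close>
  have sq: "even x \<and> x\<^sup>2 mod 16 \<in> {0, 4} \<or> odd x \<and> x\<^sup>2 mod 16 \<in> {1, 9}" for x :: int
  proof -
    have "x mod 8 \<in> {0,1,2,3,4,5,6,7}" by auto
    moreover have "x\<^sup>2 mod 16 = (x mod 8)\<^sup>2 mod 16"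
    proof -
      define u where "u = x div 8"
      define v where "v = x mod 8"
      have "x = 8 * u + v" by (simp add: u_def v_def)
      then have "x\<^sup>2 = v\<^sup>2 + 16 * (4 * u\<^sup>2 + u * v)" by (simp add: algebra_simps power2_eq_square)
      then show ?thesis unfolding v_def[symmetric] by (simp only: mod_mult_self2)
    qed
    moreover have "even x \<longleftrightarrow> even (x mod 8)" by presburger
    ultimately show ?thesis by auto
  qed
  define A where "A = a\<^sup>2" define B where "B = b\<^sup>2" define C where "C = c\<^sup>2" define D where "D = d\<^sup>2"
  have 1: "16 dvd A + B + 2 * C + 2 * D" using assms by (simp add: A_def B_def C_def D_def)
  have "(A mod 16 + B mod 16 + 2 * (C mod 16) + 2 * (D mod 16)) mod 16 = (A + B + 2 * C + 2 * D) mod 16"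
    by (intro mod_add_cong mod_mult_cong) simp_all
  also have "\<dots> = 0" using 1 by (simp only: dvd_eq_mod_eq_0)
  finally have sum: "(A mod 16 + B mod 16 + 2 * (C mod 16) + 2 * (D mod 16)) mod 16 = 0" .
  have parity: "P \<and> Q \<and> R \<and> S"
    if "(A + B + 2 * C + 2 * D) mod 16 = 0"
      "P \<and> A \<in> {0, 4} \<or> \<not> P \<and> A \<in> {1, 9}" "Q \<and> B \<in> {0, 4} \<or> \<not> Q \<and> B \<in> {1, 9}"
      "R \<and> C \<in> {0, 4} \<or> \<not> R \<and> C \<in> {1, 9}" "S \<and> D \<in> {0, 4} \<or> \<not> S \<and> D \<in> {1, 9}"
    for P Q R S and A B C D :: int
    using that by (elim disjE conjE insertE emptyE) simp_all
  show ?thesis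
    using sum unfolding A_def B_def C_def D_def by (rule parity) (rule sq)+
qed

text \<open>Descent: the factor 4 of \<open>D\<close> together with one factor 4 of the power
  supplies the 16 needed to halve all variables.\<close>

lemma power_two_dvd_of_power_four_dvd:
  fixes a b c d D :: int
  assumes "4 dvd D" "a\<^sup>2 + b\<^sup>2 + 2 * c\<^sup>2 + 2 * d\<^sup>2 = 4 ^ e * D"
  shows "\<exists>a' b' c' d'. a = 2 ^ e * a' \<and> b = 2 ^ e * b' \<and> c = 2 ^ e * c' \<and> d = 2 ^ e * d' \<and>
           a'\<^sup>2 + b'\<^sup>2 + 2 * c'\<^sup>2 + 2 * d'\<^sup>2 = D"
  using assms(2)
proof (induction e arbitrary: a b c d)
  case 0
  then show ?case by simp
next
  case (Suc e)
  obtain D' where "D = 4 * D'" using assms(1) by blast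
  then have "a\<^sup>2 + b\<^sup>2 + 2 * c\<^sup>2 + 2 * d\<^sup>2 = 16 * (4 ^ e * D')" using Suc.prems by simp
  then have "even a \<and> even b \<and> even c \<and> even d" by (intro even_of_16_dvd) simp
  then obtain a1 b1 c1 d1 where *: "a = 2 * a1" "b = 2 * b1" "c = 2 * c1" "d = 2 * d1"
    by (elim conjE evenE)
  have "a1\<^sup>2 + b1\<^sup>2 + 2 * c1\<^sup>2 + 2 * d1\<^sup>2 = 4 ^ e * D"
    using Suc.prems by (simp add: * power_mult_distrib)
  from Suc.IH[OF this] show ?case by (auto simp: * mult.assoc)
qed

text \<open>Choose \<open>N\<close> with
  \<open>4 * k * N + 6 * (k - 1)\<^sup>2 = 4 ^ e * (6 + 2 * k)\<close>. A representation of
  \<open>N\<close> yields squares of numbers congruent to 1 modulo \<open>k\<close>, and descent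
  brings them down to a representation of \<open>6 + 2 * k\<close>, too small for any variable
  except 1; but four ones give only 6.\<close>

lemma polygonal_exceptions:
  fixes k :: int
  assumes "k \<ge> 3" "odd k"
  shows "infinite {N::int. N > 0 \<and>
     \<not> (\<exists>x1 x2 x3 x4 :: nat. N = polygonal (2 * k + 2) (int x1) + polygonal (2 * k + 2) (int x2)
          + 2 * polygonal (2 * k + 2) (int x3) + 2 * polygonal (2 * k + 2) (int x4))}"
    (is "infinite ?E")
proof
  assume fin: "finite ?E"
  define B where "B = Max (insert 0 ?E)"
  have B: "N \<le> B" if "N \<in> ?E" for N
    unfolding B_def using fin that by (intro Max_ge) auto
  have B0: "B \<ge> 0" unfolding B_def using fin by (intro Max_ge) auto
  \<comment> \<open>The totient makes \<open>X = 2 ^ e\<close> congruent to 1 modulo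
    \<open>k\<close>; the other factor makes \<open>X\<close> large enough to push \<open>N\<close>
    beyond \<open>B\<close>.\<close>
  define e where "e = totient (nat k) * (nat k * nat (B + 6 * (k - 1)\<^sup>2 + 1) * 4)"
  define X :: int where "X = 2 ^ e"
  have "coprime 2 (nat k)"
    using assms by (simp add: coprime_left_2_iff_odd even_nat_iff)
  then have "[2 ^ totient (nat k) = 1] (mod nat k)" by (rule euler_theorem)
  then have "[(2 ^ totient (nat k)) ^ (nat k * nat (B + 6 * (k - 1)\<^sup>2 + 1) * 4) = 1 ^ (nat k * nat (B + 6 * (k - 1)\<^sup>2 + 1) * 4)] (mod nat k)"
    by (rule cong_pow)
  then have "[2 ^ e = 1] (mod nat k)" by (simp add: e_def power_mult)
  then have "[int (2 ^ e) = int 1] (mod int (nat k))" by (subst cong_int_iff)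
  then have X1: "[X = 1] (mod k)" using assms by (simp add: X_def)
  have "totient (nat k) > 0" using assms by simp
  then have "totient (nat k) \<ge> 1" by linarith
  then have "nat k * nat (B + 6 * (k - 1)\<^sup>2 + 1) * 4 \<le> e"
    unfolding e_def by (metis mult_1 mult_le_mono1)
  also have "int e \<le> X" unfolding X_def
    using less_exp[of e] by (metis of_nat_le_iff of_nat_numeral of_nat_power less_imp_le)
  finally have "int (nat k * nat (B + 6 * (k - 1)\<^sup>2 + 1) * 4) \<le> X" by simp
  then have Xbig: "4 * k * (B + 6 * (k - 1)\<^sup>2 + 1) \<le> X"
    using assms B0 by (simp add: algebra_simps)
  have kB: "k * 1 \<le> k * (B + 6 * (k - 1)\<^sup>2 + 1)"
    using assms B0 by (intro mult_left_mono) auto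
  then have Xk: "X > k" using Xbig assms by linarith
  define M where "M = X\<^sup>2 * (6 + 2 * k) - 6 * (k - 1)\<^sup>2"
  have M4: "4 dvd M"
  proof -
    obtain l where l: "k = 2 * l + 1" using assms(2) by (rule oddE)
    have "M = 4 * (X\<^sup>2 * (l + 2) - 6 * l\<^sup>2)"
      by (simp add: M_def l algebra_simps power2_eq_square)
    then show ?thesis by simp
  qed
  have "[M = 1\<^sup>2 * (6 + 2 * 0) - 6 * (0 - 1)\<^sup>2] (mod k)"
    unfolding M_def using X1
    by (intro cong_diff cong_mult cong_pow cong_add cong_refl) (auto simp: cong_0_iff)
  then have Mk: "k dvd M" by (simp add: cong_0_iff)
  have "coprime 4 k" using assms(2)
    using coprime_mult_left_iff[of 2 2 k] by simp
  then have "4 * k dvd M" using M4 Mk by (simp add: divides_mult)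
  then obtain N where N: "M = 4 * k * N" by blast
  have "X * X \<ge> X * 1" using Xk assms by (intro mult_left_mono) auto
  then have "X \<le> X\<^sup>2" by (simp add: power2_eq_square)
  moreover have "X\<^sup>2 * 1 \<le> X\<^sup>2 * (6 + 2 * k)" using assms by (intro mult_left_mono) auto
  ultimately have "4 * k * (B + 6 * (k - 1)\<^sup>2 + 1) \<le> X\<^sup>2 * (6 + 2 * k)" using Xbig by linarith
  moreover have "1 * (6 * (k - 1)\<^sup>2) \<le> 4 * k * (6 * (k - 1)\<^sup>2)" using assms by (intro mult_right_mono) auto
  ultimately have "4 * k * (B + 1) \<le> M" unfolding M_def by (simp add: algebra_simps)
  then have NB: "N \<ge> B + 1" using assms by (simp add: N)
  have "N \<in> ?E"
  proof (clarsimp, intro conjI allI notI)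
    show "0 < N" using NB B0 by linarith
    fix x1 x2 x3 x4 :: nat
    assume eq: "N = polygonal (2 * k + 2) (int x1) + polygonal (2 * k + 2) (int x2)
      + 2 * polygonal (2 * k + 2) (int x3) + 2 * polygonal (2 * k + 2) (int x4)"
    define y where "y x = 2 * k * int x - (k - 1)" for x :: nat
    have "(y x1)\<^sup>2 + (y x2)\<^sup>2 + 2 * (y x3)\<^sup>2 + 2 * (y x4)\<^sup>2 = 4 * k * N + 6 * (k - 1)\<^sup>2"
      unfolding y_def complete_square_polygonal[symmetric] eq by (simp add: algebra_simps)
    also have "\<dots> = 4 ^ e * (6 + 2 * k)"
      using N by (simp add: M_def X_def power_mult[symmetric] mult.commute[of e] power_mult)
    finally have sum: "(y x1)\<^sup>2 + (y x2)\<^sup>2 + 2 * (y x3)\<^sup>2 + 2 * (y x4)\<^sup>2 = 4 ^ e * (6 + 2 * k)" .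
    have "4 dvd 6 + 2 * k" using assms(2) by (auto elim!: oddE)
    from power_two_dvd_of_power_four_dvd[OF this sum] obtain z1 z2 z3 z4 where
      z: "y x1 = X * z1" "y x2 = X * z2" "y x3 = X * z3" "y x4 = X * z4"
      and zs: "z1\<^sup>2 + z2\<^sup>2 + 2 * z3\<^sup>2 + 2 * z4\<^sup>2 = 6 + 2 * k"
      unfolding X_def by blast
    \<comment> \<open>Since \<open>X\<close> is 1 modulo \<open>k\<close>, so is \<open>z\<close>.
      Nonnegativity of \<open>x\<close> gives \<open>y x > - k\<close>, and as \<open>X > k\<close>
      this excludes negative \<open>z\<close>.\<close>
    have key: "z \<ge> 1 \<and> (z = 1 \<or> z \<ge> k + 1)" if "y x = X * z" for x z
    proof -
      have "[X * z = 1 * z] (mod k)" using X1 by (intro cong_mult cong_refl)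
      moreover have "[y x = 1] (mod k)"
        unfolding y_def cong_iff_dvd_diff by (auto simp: algebra_simps)
      ultimately have "[z = 1] (mod k)" using that by (metis cong_sym cong_trans mult_1)
      then obtain l where l: "z = 1 + k * l" by (metis cong_iff_lin cong_sym)
      have "y x > - k" using assms by (simp add: y_def)
      have "l \<ge> 0"
      proof (rule ccontr)
        assume "\<not> l \<ge> 0"
        then have "k * l \<le> k * (-1)" using assms by (intro mult_left_mono) auto
        then have "z \<le> -1" using l assms by linarith
        then have "X * z \<le> X * (-1)" using Xk assms by (intro mult_left_mono) auto
        then show False using \<open>y x > - k\<close> that Xk by linarith
      qed
      moreover have "k * 1 \<le> k * l" if "l \<ge> 1" using assms that by (intro mult_left_mono) auto
      ultimately show ?thesis using l assms by (cases "l = 0") auto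
    qed
    note ks = key[OF z(1)] key[OF z(2)] key[OF z(3)] key[OF z(4)]
    have sq1: "1 \<le> z\<^sup>2" if "z \<ge> 1" for z :: int using that by simp
    have sqk: "(k + 1)\<^sup>2 \<le> z\<^sup>2" if "z \<ge> k + 1" for z :: int using that assms by (intro power_mono) auto
    have big: "(k + 1)\<^sup>2 > 1 + 2 * k" using assms by (simp add: algebra_simps power2_eq_square)
    have "z1 = 1 \<and> z2 = 1 \<and> z3 = 1 \<and> z4 = 1"
      using ks sq1[of z1] sq1[of z2] sq1[of z3] sq1[of z4]
        sqk[of z1] sqk[of z2] sqk[of z3] sqk[of z4] big zs by linarith
    then show False using zs assms by simp
  qed
  then show False using B NB by fastforce
qed

section \<open>Representation of large integers\<close>

text \<open>The number of variables prime to 3 is congruent to \<open>n\<close>, hence 0, 2 or 3,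
  and suitable signs make the sum divisible by 3.\<close>

lemma sum_three_squares_dvd_3:
  assumes "sum_three_squares n" "n mod 3 \<noteq> 1"
  obtains x y z where "n = x\<^sup>2 + y\<^sup>2 + z\<^sup>2" "3 dvd x + y + z"
proof -
  have sign: "\<exists>x'. x'\<^sup>2 = x\<^sup>2 \<and> x' mod 3 \<in> {0, 1} \<and> x\<^sup>2 mod 3 = x' mod 3" for x :: int
  proof -
    define x' where "x' = (if x mod 3 = 2 then - x else x)"
    have "x mod 3 = 0 \<or> x mod 3 = 1 \<or> x mod 3 = 2" by presburger
    moreover have "(- x) mod 3 = 1" if "x mod 3 = 2" using that by presburger
    ultimately have "x' mod 3 = 0 \<or> x' mod 3 = 1" unfolding x'_def by (elim disjE) simp_all
    then have x': "x' mod 3 \<in> {0, 1}" by simp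
    have "x'\<^sup>2 mod 3 = (x' mod 3)\<^sup>2 mod 3" by (simp add: power_mod)
    also have "\<dots> = x' mod 3" using x' by (elim insertE emptyE) simp_all
    finally have "x'\<^sup>2 mod 3 = x' mod 3" .
    moreover have "x'\<^sup>2 = x\<^sup>2" by (simp add: x'_def)
    ultimately show ?thesis using x' by (intro exI[of _ x'] conjI) simp_all
  qed
  obtain x0 y0 z0 where n: "n = x0\<^sup>2 + y0\<^sup>2 + z0\<^sup>2"
    using assms(1) unfolding sum_three_squares_def by blast
  obtain x where x: "x\<^sup>2 = x0\<^sup>2" "x mod 3 \<in> {0, 1}" "x0\<^sup>2 mod 3 = x mod 3"
    using sign[of x0] by (elim exE conjE) (rule that)
  obtain y where y: "y\<^sup>2 = y0\<^sup>2" "y mod 3 \<in> {0, 1}" "y0\<^sup>2 mod 3 = y mod 3"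
    using sign[of y0] by (elim exE conjE) (rule that)
  obtain z where z: "z\<^sup>2 = z0\<^sup>2" "z mod 3 \<in> {0, 1}" "z0\<^sup>2 mod 3 = z mod 3"
    using sign[of z0] by (elim exE conjE) (rule that)
  have "n mod 3 = (x mod 3 + y mod 3 + z mod 3) mod 3"
    unfolding x(3)[symmetric] y(3)[symmetric] z(3)[symmetric] n by (intro mod_add_cong) simp_all
  then have n3: "(x mod 3 + y mod 3 + z mod 3) mod 3 \<noteq> 1" using assms(2) by metis
  have "3 dvd x + y + z \<or> 3 dvd - x + y + z \<or> 3 dvd x - y + z"
  proof -
    define X Y Z e f g where "X = x div 3" and "Y = y div 3" and "Z = z div 3"
      and "e = x mod 3" and "f = y mod 3" and "g = z mod 3"
    note defs = this
    have xyz: "x = 3 * X + e" "y = 3 * Y + f" "z = 3 * Z + g" unfolding defs by simp_all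
    have efg: "e = 0 \<or> e = 1" "f = 0 \<or> f = 1" "g = 0 \<or> g = 1" "(e + f + g) mod 3 \<noteq> 1"
      unfolding defs using x(2) y(2) z(2) n3 by blast+
    from efg have "e + f + g = 0 \<or> e + f + g = 3 \<or> f + g = e \<or> e + g = f"
      by (elim disjE) simp_all
    then consider "x + y + z = 3 * (X + Y + Z)" | "x + y + z = 3 * (X + Y + Z + 1)"
        | "- x + y + z = 3 * (Y + Z - X)" | "x - y + z = 3 * (X - Y + Z)"
      unfolding xyz by (elim disjE) (simp_all add: algebra_simps)
    then show ?thesis by cases (simp_all only: dvd_triv_left simp_thms)
  qed
  moreover have "n = x\<^sup>2 + y\<^sup>2 + z\<^sup>2" using n x(1) y(1) z(1) by simp
  ultimately show ?thesis
    using that[of x y z] that[of "- x" y z] that[of x "- y" z] by auto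
qed

text \<open>
  The form \<open>2 * u\<^sup>2 + 3 * v\<^sup>2 + 6 * w\<^sup>2\<close> is \<open>x\<^sup>2 + y\<^sup>2 + z\<^sup>2\<close> on the sublattice spanned by
  the orthogonal vectors \<open>(1, -1, 0)\<close>, \<open>(1, 1, 1)\<close> and \<open>(1, 1, -2)\<close>.
\<close>
lemma represented_by_2_3_6:
  assumes "sum_three_squares n" "n mod 3 \<noteq> 1"
  obtains u v w where "n = 2 * u\<^sup>2 + 3 * v\<^sup>2 + 6 * w\<^sup>2"
proof -
  have main: "\<exists>u v w. n = 2 * u\<^sup>2 + 3 * v\<^sup>2 + 6 * w\<^sup>2"
    if *: "n = x\<^sup>2 + y\<^sup>2 + z\<^sup>2" "3 dvd x + y + z" "even (x - y)" for x y z
  proof -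
    obtain u where u: "x - y = 2 * u" using *(3) by blast
    obtain v where v: "x + y + z = 3 * v" using *(2) by blast
    have "even (v - z)" using u v by presburger
    then obtain w where w: "v - z = 2 * w" by blast
    have xyz: "x = v + u + w" "y = v - u + w" "z = v - 2 * w" using u v w by linarith+
    have "n = 2 * u\<^sup>2 + 3 * v\<^sup>2 + 6 * w\<^sup>2"
      unfolding *(1) xyz by (simp add: algebra_simps power2_eq_square)
    then show ?thesis by blast
  qed
  obtain x y z where xyz: "n = x\<^sup>2 + y\<^sup>2 + z\<^sup>2" "3 dvd x + y + z"
    using sum_three_squares_dvd_3[OF assms] .
  \<comment> \<open>Two of three integers share their parity; the conditions are symmetric, so these
    two may come first.\<close>
  have "even (x - y) \<or> even (y - z) \<or> even (x - z)" by auto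
  then have "\<exists>u v w. n = 2 * u\<^sup>2 + 3 * v\<^sup>2 + 6 * w\<^sup>2"
    using main[of x y z] main[of y z x] main[of x z y] xyz by (auto simp: ac_simps)
  then show ?thesis using that by blast
qed

text \<open>Put \<open>s = x1 + x2\<close>, \<open>t = x3 + x4\<close>, \<open>u = s - t\<close>,
  \<open>v = x1 - x2\<close>, \<open>w = x3 - x4\<close>. Then \<open>b = s + 2 * t\<close> and
  \<open>6 * a - b\<^sup>2 = 2 * u\<^sup>2 + 3 * v\<^sup>2 + 6 * w\<^sup>2\<close>, and
  nonnegativity means \<open>\<bar>v\<bar> \<le> s\<close> and
  \<open>\<bar>w\<bar> \<le> t\<close>.\<close>

lemma weighted_Cauchy_lemma:
  fixes a b :: int
  assumes "even (a - b)" "sum_three_squares (6 * a - b\<^sup>2)" "b \<ge> 0" "5 * a \<le> b\<^sup>2"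
  obtains x1 x2 x3 x4 :: int where
    "x1 \<ge> 0" "x2 \<ge> 0" "x3 \<ge> 0" "x4 \<ge> 0"
    "a = x1\<^sup>2 + x2\<^sup>2 + 2 * x3\<^sup>2 + 2 * x4\<^sup>2" "b = x1 + x2 + 2 * x3 + 2 * x4"
proof -
  define n where "n = 6 * a - b\<^sup>2"
  have sq3: "x\<^sup>2 mod 3 = (if 3 dvd x then 0 else 1)" for x :: int
  proof -
    have "x mod 3 = 0 \<or> x mod 3 = 1 \<or> x mod 3 = 2" by presburger
    moreover have "x\<^sup>2 mod 3 = (x mod 3)\<^sup>2 mod 3" by (simp add: power_mod)
    moreover have "3 dvd x \<longleftrightarrow> x mod 3 = 0" by presburger
    ultimately show ?thesis by (elim disjE) simp_all
  qed
  have "n mod 3 \<noteq> 1"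
  proof -
    have "b\<^sup>2 mod 3 = 0 \<or> b\<^sup>2 mod 3 = 1" by (simp add: sq3)
    then show ?thesis unfolding n_def by presburger
  qed
  then obtain u0 v w where uvw0: "n = 2 * u0\<^sup>2 + 3 * v\<^sup>2 + 6 * w\<^sup>2"
    using represented_by_2_3_6 assms(2) n_def by metis
  \<comment> \<open>Solving for \<open>s\<close> and \<open>t\<close> needs \<open>b - u\<close>
    divisible by 3; as the squares agree modulo 3, the sign of \<open>u\<close> can be chosen
    so.\<close>
  have "b\<^sup>2 = u0\<^sup>2 + 3 * (2 * a - u0\<^sup>2 - v\<^sup>2 - 2 * w\<^sup>2)" using uvw0 n_def by simp
  then have "b\<^sup>2 mod 3 = u0\<^sup>2 mod 3" by (simp only: mod_mult_self2)
  then have "(if 3 dvd b then 0 else 1) = (if 3 dvd u0 then 0 else 1 :: int)" by (simp only: sq3)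
  then have "3 dvd u0 \<longleftrightarrow> 3 dvd b" by (auto split: if_splits)
  then have "3 dvd b - u0 \<or> 3 dvd b + u0" by presburger
  then obtain u where u: "u\<^sup>2 = u0\<^sup>2" "3 dvd b - u"
    by (metis diff_minus_eq_add power2_minus)
  have uvw: "n = 2 * u\<^sup>2 + 3 * v\<^sup>2 + 6 * w\<^sup>2" using uvw0 u(1) by simp
  obtain t where t: "b - u = 3 * t" using u(2) by blast
  define s where "s = u + t"
  have b: "b = s + 2 * t" and u_st: "u = s - t" using t by (simp_all add: s_def)
  have n_le: "5 * n \<le> b\<^sup>2" using assms(4) by (simp add: n_def)
  \<comment> \<open>Cauchy-Schwarz as an identity. The constant 9/3 + 4/2 = 5 is the source of the
    hypothesis \<open>5 * a \<le> b\<^sup>2\<close>; the analogous one for \<open>w\<close> is 9/6 +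
    1/2 = 2.\<close>
  have "(3 * \<bar>v\<bar> - 2 * u)\<^sup>2 + 6 * (\<bar>v\<bar> + u)\<^sup>2 + 30 * w\<^sup>2 = 5 * n"
    unfolding uvw by (simp add: algebra_simps power2_eq_square)
  then have "(3 * \<bar>v\<bar> - 2 * u)\<^sup>2 \<le> b\<^sup>2" using n_le by (smt (verit) zero_le_power2)
  then have "3 * \<bar>v\<bar> - 2 * u \<le> b" using assms(3) by (rule power2_le_imp_le)
  then have v_le: "\<bar>v\<bar> \<le> s" using b u_st by linarith
  have "(3 * \<bar>w\<bar> + u)\<^sup>2 + 3 * (\<bar>w\<bar> - u)\<^sup>2 + 6 * v\<^sup>2 = 2 * n"
    unfolding uvw by (simp add: algebra_simps power2_eq_square)
  moreover have "0 \<le> n" unfolding uvw by simp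
  ultimately have "(3 * \<bar>w\<bar> + u)\<^sup>2 \<le> b\<^sup>2" using n_le by (smt (verit) zero_le_power2)
  then have "3 * \<bar>w\<bar> + u \<le> b" using assms(3) by (rule power2_le_imp_le)
  then have w_le: "\<bar>w\<bar> \<le> t" using t by linarith
  have eq: "6 * a = b\<^sup>2 + 2 * u\<^sup>2 + 3 * v\<^sup>2 + 6 * w\<^sup>2" using uvw n_def by simp
  then have "b\<^sup>2 + 3 * v\<^sup>2 = 2 * (3 * a - u\<^sup>2 - 3 * w\<^sup>2)" by simp
  then have "even (b\<^sup>2 + 3 * v\<^sup>2)" by simp
  then have "even (b + v)" by simp
  then have "even (s + v)" using b by simp
  then obtain x1 where x1: "s + v = 2 * x1" by blast
  then have v: "v = 2 * x1 - s" by simp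
  have "6 * a = (s + 2 * t)\<^sup>2 + 2 * (s - t)\<^sup>2 + 3 * (2 * x1 - s)\<^sup>2 + 6 * w\<^sup>2"
    using eq unfolding b u_st v .
  then have a: "a = s\<^sup>2 - 2 * s * x1 + 2 * x1\<^sup>2 + t\<^sup>2 + w\<^sup>2"
    by (simp add: algebra_simps power2_eq_square)
  \<comment> \<open>Here the equal parity of \<open>a\<close> and \<open>b\<close> enters; the
    parity of \<open>s + v\<close> came from \<open>6 * a\<close> being even.\<close>
  have "even (s\<^sup>2 + t\<^sup>2 + w\<^sup>2 - s)" using assms(1) unfolding a b by simp
  then have "even (t + w)" by simp argo
  then obtain x3 where x3: "t + w = 2 * x3" by blast
  show ?thesis
  proof (rule that[of x1 "s - x1" x3 "t - x3"])
    show "0 \<le> x1" "0 \<le> s - x1" "0 \<le> x3" "0 \<le> t - x3" using x1 x3 v_le w_le by linarith+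
    show "b = x1 + (s - x1) + 2 * x3 + 2 * (t - x3)" by (simp add: b)
    have w: "w = 2 * x3 - t" using x3 by simp
    show "a = x1\<^sup>2 + (s - x1)\<^sup>2 + 2 * x3\<^sup>2 + 2 * (t - x3)\<^sup>2"
      unfolding a w by (simp add: algebra_simps power2_eq_square)
  qed
qed

lemma polygonal_representation_if_sum_three_squares:
  fixes m b l :: int
  assumes "sum_three_squares (6 * (b + 2 * l) - b\<^sup>2)" "b \<ge> 0" "5 * (b + 2 * l) \<le> b\<^sup>2"
  shows "\<exists>x1 x2 x3 x4 :: nat. b + m * l = polygonal (m + 2) (int x1) + polygonal (m + 2) (int x2)
                  + 2 * polygonal (m + 2) (int x3) + 2 * polygonal (m + 2) (int x4)"
proof -
  have "even (b + 2 * l - b)" by simp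
  from weighted_Cauchy_lemma[OF this assms] obtain x1 x2 x3 x4 :: int
    where x: "x1 \<ge> 0" "x2 \<ge> 0" "x3 \<ge> 0" "x4 \<ge> 0"
    and a: "b + 2 * l = x1\<^sup>2 + x2\<^sup>2 + 2 * x3\<^sup>2 + 2 * x4\<^sup>2"
    and b: "b = x1 + x2 + 2 * x3 + 2 * x4" .
  have poly: "2 * polygonal (m + 2) x = m * (x\<^sup>2 - x) + 2 * x" for x
  proof -
    have "2 * (x * (x - 1) div 2) = x * (x - 1)" by simp
    then have "2 * polygonal (m + 2) x = m * (x * (x - 1)) + 2 * x"
      unfolding polygonal_def by (simp add: algebra_simps)
    then show ?thesis by (simp add: algebra_simps power2_eq_square)
  qed
  have "2 * (b + m * l) = m * (b + 2 * l) + (2 - m) * b" by (simp add: algebra_simps)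
  also have "\<dots> = m * (x1\<^sup>2 + x2\<^sup>2 + 2 * x3\<^sup>2 + 2 * x4\<^sup>2) + (2 - m) * (x1 + x2 + 2 * x3 + 2 * x4)"
    by (simp only: a b[symmetric])
  also have "\<dots> = 2 * polygonal (m + 2) x1 + 2 * polygonal (m + 2) x2
      + 2 * (2 * polygonal (m + 2) x3) + 2 * (2 * polygonal (m + 2) x4)"
    unfolding poly by (simp add: algebra_simps)
  finally have "b + m * l = polygonal (m + 2) x1 + polygonal (m + 2) x2
      + 2 * polygonal (m + 2) x3 + 2 * polygonal (m + 2) x4" by simp
  then show ?thesis using x
    by (intro exI[of _ "nat x1"] exI[of _ "nat x2"] exI[of _ "nat x3"] exI[of _ "nat x4"]) simp
qed

text \<open>
  With \<open>a = b + 2 * (N - b) / m\<close>, every \<open>b\<close> between \<open>sqrt (10 * N / m) + 5\<close> and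
  \<open>sqrt (12 * N / m)\<close> satisfies the inequalities; this interval is longer than \<open>4 * m\<close>.
\<close>
lemma exists_admissible_b:
  fixes m N r :: int
  assumes m: "m \<ge> 3" and N: "N \<ge> 1628 * m ^ 3" and r: "m dvd N - r"
  obtains b l where "b \<ge> 0" "[b = r] (mod 4 * m)" "N = b + m * l"
    "5 * (b + 2 * l) \<le> b\<^sup>2" "b\<^sup>2 \<le> 6 * (b + 2 * l)"
proof -
  define K :: real where "K = 2 * of_int N / of_int m"
  have m0: "(0 :: real) < of_int m" using m by simp
  have "1628 * (of_int m :: real) ^ 3 \<le> of_int N"
    using N by (metis of_int_le_iff of_int_mult of_int_numeral of_int_power)
  then have "3256 * (of_int m :: real) ^ 2 \<le> K"
    using m0 by (simp add: K_def field_simps power2_eq_square power3_eq_cube)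
  \<comment> \<open>\<open>57\<^sup>2 = 3249\<close> is below
    \<open>3256 = 2 * 1628\<close>.\<close>
  then have "(57 * of_int m)\<^sup>2 \<le> K" using m0 by (simp add: power_mult_distrib) (smt (verit) zero_le_power2)
  then have c: "57 * of_int m \<le> sqrt K" by (rule real_le_rsqrt)
  have K0: "K \<ge> 0" using \<open>(57 * of_int m)\<^sup>2 \<le> K\<close> by (smt (verit) zero_le_power2)
  \<comment> \<open>The margin 5 yields \<open>(b - 5)\<^sup>2 \<ge> 5 * K\<close> with
    \<open>b \<ge> 5\<close>, hence \<open>b\<^sup>2 \<ge> 5 * K + 5 * b\<close>, which absorbs the
    term \<open>5 * b\<close> in the target.\<close>
  define lo where "lo = \<lceil>sqrt 5 * sqrt K + 5\<rceil>"
  define b where "b = lo + (r - lo) mod (4 * m)"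
  have "[b = lo + (r - lo)] (mod 4 * m)" unfolding b_def by (intro cong_add) (auto simp: cong_def)
  then have br: "[b = r] (mod 4 * m)" by simp
  then have "m dvd b - r" by (metis cong_iff_dvd_diff dvd_mult_right)
  then have "m dvd N - b" using r by (metis dvd_diff diff_diff_eq2 diff_add_cancel)
  then obtain l where "N - b = m * l" by blast
  then have l: "N = b + m * l" by simp
  have "(r - lo) mod (4 * m) \<ge> 0" "(r - lo) mod (4 * m) \<le> 4 * m" using m by (auto intro: less_imp_le)
  then have b_lo: "lo \<le> b" and b_hi: "b \<le> lo + 4 * m" unfolding b_def by linarith+
  have B1: "sqrt 5 * sqrt K + 5 \<le> of_int b" using b_lo unfolding lo_def by linarith
  have "of_int b \<le> of_int lo + 4 * (of_int m :: real)" using b_hi by (metis of_int_add of_int_le_iff of_int_mult of_int_numeral)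
  then have B2: "of_int b \<le> sqrt 5 * sqrt K + 6 + 4 * of_int m" unfolding lo_def by linarith
  have "sqrt 5 \<le> sqrt ((22361/10000)\<^sup>2)" by (intro real_sqrt_le_mono) (simp add: power2_eq_square)
  then have s5: "sqrt 5 \<le> 22361/10000" by simp
  have "sqrt ((24494/10000)\<^sup>2) \<le> sqrt 6" by (intro real_sqrt_le_mono) (simp add: power2_eq_square)
  then have s6: "24494/10000 \<le> sqrt 6" by simp
  \<comment> \<open>Since 0.2133 * 57 > 12, the gap exceeds \<open>12 * m\<close>, which covers
    \<open>4 * m\<close> for the residue class and 6 for the margin and the rounding.\<close>
  have "(2133/10000) * sqrt K \<le> (sqrt 6 - sqrt 5) * sqrt K"
    using s5 s6 K0 by (intro mult_right_mono) auto
  then have "6 + 4 * of_int m \<le> (sqrt 6 - sqrt 5) * sqrt K" using c m by linarith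
  then have B3: "of_int b \<le> sqrt 6 * sqrt K" using B2 by (simp add: algebra_simps)
  have b0: "(0::real) \<le> of_int b" using B1 K0 by (smt (verit) mult_nonneg_nonneg real_sqrt_ge_zero)
  have "(of_int b)\<^sup>2 \<le> (sqrt 6 * sqrt K)\<^sup>2" using B3 b0 by (rule power_mono)
  then have U: "(of_int b)\<^sup>2 \<le> 6 * K" using K0 by (simp add: power_mult_distrib)
  have "(sqrt 5 * sqrt K)\<^sup>2 \<le> (of_int b - 5)\<^sup>2" using B1 K0 by (intro power_mono) auto
  then have "5 * K \<le> (of_int b - 5)\<^sup>2" using K0 by (simp add: power_mult_distrib)
  moreover have "(of_int b - 5)\<^sup>2 \<le> (of_int b)\<^sup>2 - 5 * (of_int b :: real)"
  proof -
    have "(of_int b - 5)\<^sup>2 = (of_int b)\<^sup>2 - 10 * (of_int b :: real) + 25"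
      by (simp add: power2_eq_square algebra_simps)
    moreover have "0 \<le> sqrt 5 * sqrt K" using K0 by simp
    ultimately show ?thesis using B1 by linarith
  qed
  ultimately have L: "5 * K + 5 * of_int b \<le> (of_int b)\<^sup>2" by linarith
  have Kl: "K = 2 * of_int l + 2 * of_int b / of_int m"
    using m0 by (simp add: K_def l field_simps)
  have bm: "0 \<le> 2 * of_int b / (of_int m :: real)" "2 * of_int b / (of_int m :: real) \<le> of_int b"
    using b0 m0 m mult_right_mono[of 2 "of_int m :: real" "of_int b"] by (simp_all add: field_simps)
  show ?thesis
  proof (rule that[of b l])
    show "b \<ge> 0" using b0 by simp
    have "5 * (of_int b + 2 * of_int l) \<le> (of_int b :: real)\<^sup>2" using L bm Kl by argo
    then have "(of_int (5 * (b + 2 * l)) :: real) \<le> of_int (b\<^sup>2)" by simp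
    then show "5 * (b + 2 * l) \<le> b\<^sup>2" by (simp only: of_int_le_iff)
    have "(of_int b :: real)\<^sup>2 \<le> 6 * (of_int b + 2 * of_int l)" using U bm Kl by argo
    then have "(of_int (b\<^sup>2) :: real) \<le> of_int (6 * (b + 2 * l))" by simp
    then show "b\<^sup>2 \<le> 6 * (b + 2 * l)" by (simp only: of_int_le_iff)
  qed (use br l in auto)
qed

lemma sum_three_squares_mult_square:
  assumes "sum_three_squares n"
  shows "sum_three_squares (f\<^sup>2 * n)"
proof -
  obtain x y z where "n = x\<^sup>2 + y\<^sup>2 + z\<^sup>2" using assms unfolding sum_three_squares_def by blast
  then have "f\<^sup>2 * n = (f * x)\<^sup>2 + (f * y)\<^sup>2 + (f * z)\<^sup>2" by (simp add: power_mult_distrib distrib_left)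
  then show ?thesis unfolding sum_three_squares_def by blast
qed

lemma odd_square_mod_4: "odd (b :: int) \<Longrightarrow> b\<^sup>2 mod 4 = 1"
proof (elim oddE)
  fix c assume "b = 2 * c + 1"
  then have "b\<^sup>2 = 1 + 4 * (c\<^sup>2 + c)" by (simp add: power2_eq_square algebra_simps)
  then show "b\<^sup>2 mod 4 = 1" by presburger
qed

lemma mod_4_eq_1_if_odd:
  fixes a b :: int
  assumes "odd a" "odd b"
  shows "(6 * a - b\<^sup>2) mod 4 = 1"
  using odd_square_mod_4[OF assms(2)] assms(1) by presburger

text \<open>If \<open>b\<close> can be chosen odd, then \<open>6 * a - b\<^sup>2\<close> is 1 modulo
  4. Otherwise \<open>4 dvd m\<close> and \<open>N\<close> is even, so \<open>b\<close> is even, and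
  the residue of \<open>b\<close> modulo \<open>4 * m\<close> is used to make a quarter of that
  number 1 modulo 4.\<close>

lemma large_integers_represented:
  fixes m N :: int
  assumes sq: "\<And>n. n > 0 \<Longrightarrow> n mod 4 = 1 \<Longrightarrow> sum_three_squares n"
    and m: "m \<ge> 3" "odd m \<or> 4 dvd m" and N: "N \<ge> 1628 * m ^ 3"
  shows "\<exists>x1 x2 x3 x4 :: nat. N = polygonal (m + 2) (int x1) + polygonal (m + 2) (int x2)
                  + 2 * polygonal (m + 2) (int x3) + 2 * polygonal (m + 2) (int x4)"
proof -
  have "\<exists>b l. b \<ge> 0 \<and> N = b + m * l \<and> 5 * (b + 2 * l) \<le> b\<^sup>2 \<and> sum_three_squares (6 * (b + 2 * l) - b\<^sup>2)"
  proof (cases "odd m \<or> odd N")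
    case True
    \<comment> \<open>An odd representative of \<open>N\<close> modulo \<open>m\<close>; the modulus
      \<open>4 * m\<close> is even, so \<open>b\<close> inherits its parity.\<close>
    define r where "r = (if odd N then N else N + m)"
    have r: "odd r" "m dvd N - r" using True by (auto simp: r_def)
    obtain b l where bl: "b \<ge> 0" "[b = r] (mod 4 * m)" "N = b + m * l"
      "5 * (b + 2 * l) \<le> b\<^sup>2" "b\<^sup>2 \<le> 6 * (b + 2 * l)"
      using exists_admissible_b[OF m(1) N r(2)] .
    have "4 * m dvd b - r" using bl(2) by (simp add: cong_iff_dvd_diff)
    then have "even (b - r)" by (metis dvd_mult_left dvd_trans even_numeral)
    then have "odd b" using r(1) by simp
    then have "(6 * (b + 2 * l) - b\<^sup>2) mod 4 = 1" by (intro mod_4_eq_1_if_odd) auto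
    moreover from this have "6 * (b + 2 * l) - b\<^sup>2 > 0" using bl(5) by presburger
    ultimately show ?thesis using sq bl by blast
  next
    case False
    then obtain M where M: "m = 4 * M" using m(2) by auto
    obtain h where h: "N = 2 * h" using False by blast
    \<comment> \<open>The residue of \<open>a'\<close> modulo 4 that makes
      \<open>3 * a' - b'\<^sup>2\<close> congruent to 1, as \<open>b'\<close> has the parity of
      \<open>h\<close>. The choice of \<open>l0\<close> achieves it because
      \<open>a' = h + (1 - 2 * M) * l\<close> and \<open>(1 - 2 * M)\<^sup>2\<close> is 1 modulo 4;
      fixing \<open>b\<close> modulo \<open>4 * m\<close> fixes \<open>l\<close> modulo 4.\<close>
    define g where "g = (if odd h then 2 else 3 :: int)"
    define l0 where "l0 = (g - h) * (1 - 2 * M)"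
    have "m dvd N - (N - m * l0)" by simp
    from exists_admissible_b[OF m(1) N this] obtain b l where bl: "b \<ge> 0" "[b = N - m * l0] (mod 4 * m)"
      "N = b + m * l" "5 * (b + 2 * l) \<le> b\<^sup>2" "b\<^sup>2 \<le> 6 * (b + 2 * l)" .
    have "m * 4 dvd m * (l0 - l)"
      using bl(2,3) by (simp add: cong_iff_dvd_diff algebra_simps)
    then have "4 dvd l0 - l" using m(1) by simp
    then obtain i where i: "l = l0 - 4 * i" by (metis dvdE add_diff_cancel_left' diff_add_cancel)
    define b' where "b' = h - 2 * M * l"
    define a' where "a' = b' + l"
    have b: "b = 2 * b'" using bl(3) by (simp add: b'_def h M)
    have "a' = h + (1 - 2 * M) * l" by (simp add: a'_def b'_def algebra_simps)
    also have "\<dots> = g + 4 * ((g - h) * (M\<^sup>2 - M) - (1 - 2 * M) * i)"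
      by (simp add: i l0_def algebra_simps power2_eq_square)
    finally have a': "a' mod 4 = g mod 4" by presburger
    have parity: "even b' \<longleftrightarrow> even h" by (simp add: b'_def)
    have n: "6 * (b + 2 * l) - b\<^sup>2 = 2\<^sup>2 * (3 * a' - b'\<^sup>2)"
      by (simp add: b a'_def algebra_simps power2_eq_square)
    have "(3 * a' - b'\<^sup>2) mod 4 = (3 * (a' mod 4) - b'\<^sup>2 mod 4) mod 4"
      by (intro mod_diff_cong mod_mult_cong) simp_all
    also have "\<dots> = 1"
    proof (cases "odd h")
      case True
      then have "b'\<^sup>2 mod 4 = 1" using parity by (intro odd_square_mod_4) simp
      then show ?thesis using a' True by (simp only: g_def) simp
    next
      case False
      then have "even b'" using parity by simp
      then have "b'\<^sup>2 mod 4 = 0" by (auto simp: power_mult_distrib elim!: evenE)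
      then show ?thesis using a' False by (simp only: g_def) simp
    qed
    finally have mod4: "(3 * a' - b'\<^sup>2) mod 4 = 1" .
    moreover have "3 * a' - b'\<^sup>2 \<noteq> 0" using mod4 by (metis mod_0 zero_neq_one)
    moreover have "3 * a' - b'\<^sup>2 \<ge> 0" using bl(5) n by simp
    ultimately have "sum_three_squares (6 * (b + 2 * l) - b\<^sup>2)"
      unfolding n by (intro sum_three_squares_mult_square sq) simp_all
    then show ?thesis using bl by blast
  qed
  then show ?thesis using polygonal_representation_if_sum_three_squares by blast
qed

theorem theorem1p2:
  fixes m :: int
  assumes "m \<ge> 3"
  shows "(\<not> 2 dvd m \<or> 4 dvd m \<longrightarrow>
            (\<forall>N::int. N \<ge> 1628 * m ^ 3 \<longrightarrow>
              (\<exists>x1 x2 x3 x4 :: nat.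
                N = polygonal (m + 2) (int x1) + polygonal (m + 2) (int x2)
                  + 2 * polygonal (m + 2) (int x3) + 2 * polygonal (m + 2) (int x4)))) \<and>
         (m mod 4 = 2 \<longrightarrow>
            infinite {N::int. N > 0 \<and>
              \<not> (\<exists>x1 x2 x3 x4 :: nat.
                N = polygonal (m + 2) (int x1) + polygonal (m + 2) (int x2)
                  + 2 * polygonal (m + 2) (int x3) + 2 * polygonal (m + 2) (int x4))})"
proof (intro conjI impI allI)
  fix N :: int
  assume "\<not> 2 dvd m \<or> 4 dvd m" "1628 * m ^ 3 \<le> N"
  then show "\<exists>x1 x2 x3 x4 :: nat.
      N = polygonal (m + 2) (int x1) + polygonal (m + 2) (int x2)
        + 2 * polygonal (m + 2) (int x3) + 2 * polygonal (m + 2) (int x4)"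
    using assms by (intro large_integers_represented sum_three_squares_1_mod_4)
next
  assume "m mod 4 = 2"
  define k where "k = m div 2"
  have "m = 2 * k" "odd k" "k \<ge> 3"
    using assms \<open>m mod 4 = 2\<close> unfolding k_def by presburger+
  then show "infinite {N::int. N > 0 \<and>
      \<not> (\<exists>x1 x2 x3 x4 :: nat.
        N = polygonal (m + 2) (int x1) + polygonal (m + 2) (int x2)
          + 2 * polygonal (m + 2) (int x3) + 2 * polygonal (m + 2) (int x4))}"
    using polygonal_exceptions[of k] by simp
qed

end
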